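(* Let $G$ be a planar graph and $M$ a maximum matching of $G$. If $x$ is a vertex unmatched in $M$, then there exists a vertex $v\in S(x)$ with $\deg_G(v)\le 5$ (possibly $v=x$).
   Context: Graphs are finite and simple. A vertex is unmatched by a matching $M$ if it is incident to no edge of $M$. An $M$-alternating path is a path whose edges alternate between edges in $M$ and edges not in $M$. For a vertex $x$ unmatched by $M$, a vertex $v$ is switchable from $x$ if there is an $M$-alternating path of even length starting in $x$ with an edge not in $M$ and ending in $v$ with an edge in $M$. $S(x)$ denotes the set consisting of $x$ together with all vertices switchable from $x$ (with respect to $M$). *)

theory Defs
  imports "HOL-Analysis.Analysis"
begin

definition simple_graph :: "'a set \<Rightarrow> 'a set set \<Rightarrow> bool" where
  "simple_graph V E \<longleftrightarrow> finite V \<and> (\<forall>e\<in>E. e \<subseteq> V \<and> card e = 2)"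

definition vertex_degree :: "'a set set \<Rightarrow> 'a \<Rightarrow> nat" where
  "vertex_degree E v = card {e \<in> E. v \<in> e}"

text \<open>The plane is the type \<^typ>\<open>complex\<close>. Edges are drawn as arbitrary (continuous, injective)
  arcs; the interior of an edge contains no vertex and no point of any other edge. The
  orientation of the arc representing an edge is irrelevant.\<close>

definition plane_drawing ::
  "'a set \<Rightarrow> 'a set set \<Rightarrow> ('a \<Rightarrow> complex) \<Rightarrow> ('a set \<Rightarrow> real \<Rightarrow> complex) \<Rightarrow> bool" where
  "plane_drawing V E pos \<gamma> \<longleftrightarrow>
     inj_on pos V \<and>
     (\<forall>e\<in>E. arc (\<gamma> e) \<and> {pathstart (\<gamma> e), pathfinish (\<gamma> e)} = pos ` e) \<and>
     (\<forall>e\<in>E. (path_image (\<gamma> e) - pos ` e) \<inter> pos ` V = {}) \<and>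
     (\<forall>e\<in>E. \<forall>f\<in>E. e \<noteq> f \<longrightarrow> (path_image (\<gamma> e) - pos ` e) \<inter> path_image (\<gamma> f) = {})"

definition planar_graph :: "'a set \<Rightarrow> 'a set set \<Rightarrow> bool" where
  "planar_graph V E \<longleftrightarrow> simple_graph V E \<and> (\<exists>pos \<gamma>. plane_drawing V E pos \<gamma>)"

definition matching :: "'a set set \<Rightarrow> 'a set set \<Rightarrow> bool" where
  "matching E M \<longleftrightarrow> M \<subseteq> E \<and> (\<forall>e\<in>M. \<forall>f\<in>M. e \<noteq> f \<longrightarrow> e \<inter> f = {})"

definition maximum_matching :: "'a set set \<Rightarrow> 'a set set \<Rightarrow> bool" where
  "maximum_matching E M \<longleftrightarrow> matching E M \<and> (\<forall>N. matching E N \<longrightarrow> card N \<le> card M)"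

definition unmatched :: "'a set set \<Rightarrow> 'a \<Rightarrow> bool" where
  "unmatched M v \<longleftrightarrow> (\<forall>e\<in>M. v \<notin> e)"

text \<open>A path is given by the list of its vertices, which are pairwise distinct. Its length is the
  number of its edges, i.e. one less than the length of the vertex list.\<close>

definition path_edges :: "'a list \<Rightarrow> 'a set list" where
  "path_edges p = map2 (\<lambda>u v. {u, v}) p (tl p)"

definition graph_path :: "'a set \<Rightarrow> 'a set set \<Rightarrow> 'a list \<Rightarrow> bool" where
  "graph_path V E p \<longleftrightarrow> p \<noteq> [] \<and> distinct p \<and> set p \<subseteq> V \<and> set (path_edges p) \<subseteq> E"

definition alternating_path :: "'a set \<Rightarrow> 'a set set \<Rightarrow> 'a set set \<Rightarrow> 'a list \<Rightarrow> bool" where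
  "alternating_path V E M p \<longleftrightarrow> graph_path V E p \<and>
     (\<forall>i. Suc i < length (path_edges p) \<longrightarrow>
        (path_edges p ! i \<in> M \<longleftrightarrow> path_edges p ! Suc i \<notin> M))"

definition switchable :: "'a set \<Rightarrow> 'a set set \<Rightarrow> 'a set set \<Rightarrow> 'a \<Rightarrow> 'a \<Rightarrow> bool" where
  "switchable V E M x v \<longleftrightarrow>
     (\<exists>p. alternating_path V E M p \<and> hd p = x \<and> last p = v \<and>
        path_edges p \<noteq> [] \<and> even (length (path_edges p)) \<and>
        hd (path_edges p) \<notin> M \<and> last (path_edges p) \<in> M)"

definition switch_set :: "'a set \<Rightarrow> 'a set set \<Rightarrow> 'a set set \<Rightarrow> 'a \<Rightarrow> 'a set" where
  "switch_set V E M x = insert x {v. switchable V E M x v}"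

end

theory Submission
  imports Defs
begin

text \<open>Let \<open>H\<close> be the subgraph induced by the matched vertices together with \<open>x\<close>, so that \<open>M\<close> is a
  maximum matching of \<open>H\<close> missing exactly \<open>x\<close>. The set \<open>S(x)\<close> contains the set \<open>D\<close> of vertices missed
  by some maximum matching of \<open>H\<close>. Let \<open>A\<close> be the set of neighbours of \<open>D\<close> outside \<open>D\<close>. As in the
  Gallai--Edmonds theorem, deleting \<open>A\<close> lowers the matching number by \<open>|A|\<close>, and a maximum matching of
  \<open>H - A\<close> misses at most one vertex of each component of \<open>D\<close>; counting the missed vertices, \<open>D\<close> has at
  least \<open>|A| + 1\<close> components. Suppose that all degrees in \<open>D\<close> are at least \<open>6\<close>. A planar graph on
  \<open>n \<ge> 1\<close> vertices has at most \<open>3n - 3\<close> edges, so at least \<open>6|T| - (3|T| - 3) = 3|T| + 3\<close> edges meet a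
  component \<open>T\<close>. Summing over the components, at least \<open>3|D| + 3(|A| + 1)\<close> edges meet \<open>D\<close>, and they all
  lie in \<open>D \<union> A\<close>: too many for a planar graph on \<open>|D| + |A|\<close> vertices.

  The edge bound is obtained from Euler's inequality by counting faces, the components of the
  complement of the drawing: each edge borders at most two of them, and each of them borders at least
  three edges.\<close>

section \<open>Faces of plane drawings\<close>

lemma arc_midpoint:
  assumes "arc c"
  shows "c (1/2) \<in> path_image c" "c (1/2) \<noteq> pathstart c" "c (1/2) \<noteq> pathfinish c"
proof -
  have inj: "inj_on c {0..1}" using assms by (simp add: arc_def)
  show "c (1/2) \<in> path_image c" by (simp add: path_image_def)
  show "c (1/2) \<noteq> pathstart c" "c (1/2) \<noteq> pathfinish c"
    using inj_onD [OF inj, of "1/2" 0] inj_onD [OF inj, of "1/2" 1] by (auto simp: pathstart_def pathfinish_def)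
qed

text \<open>An arc \<open>d\<close> in \<open>K\<close> joins the ends of \<open>c\<close>, so
  \<open>c\<close> and \<open>d\<close> form a Jordan curve \<open>J\<close>. Both sides of
  \<open>J\<close> come arbitrarily close to the midpoint of \<open>c\<close>, and a small disc
  around it avoids \<open>K\<close>. Points of the disc on different sides lie in different new
  components, since \<open>J\<close> is contained in \<open>K\<close> together with the arc; the
  disc itself lies in a single component of the complement of \<open>K\<close>.\<close>

lemma arc_splits_component:
  fixes K :: "complex set"
  assumes K: "closed K" and c: "arc c"
    and pc: "path_component K (pathstart c) (pathfinish c)"
    and meet: "path_image c \<inter> K \<subseteq> {pathstart c, pathfinish c}"
  obtains C D where "C \<in> components (- (K \<union> path_image c))" "D \<in> components (- (K \<union> path_image c))"
    "C \<noteq> D" "C \<subseteq> connected_component_set (- K) (c (1/2))" "D \<subseteq> connected_component_set (- K) (c (1/2))"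
proof -
  let ?p = "c (1/2)"
  have ne: "pathstart c \<noteq> pathfinish c" using arc_distinct_ends [OF c] by (rule not_sym)
  obtain h where h: "path h" "path_image h \<subseteq> K" "pathstart h = pathstart c" "pathfinish h = pathfinish c"
    using pc by (auto simp: path_component_def)
  obtain d where "arc d" "path_image d \<subseteq> path_image h" "pathstart d = pathstart c" "pathfinish d = pathfinish c"
    by (rule path_contains_arc [OF h(1,3,4) ne])
  with h(2) have d: "arc d" "path_image d \<subseteq> K" "pathstart d = pathstart c" "pathfinish d = pathfinish c"
    by auto
  define J where "J = path_image (c +++ reversepath d)"
  have J: "J = path_image c \<union> path_image d"
    unfolding J_def using d by (simp add: path_image_join)
  have sp: "simple_path (c +++ reversepath d)"
    using c d meet by (intro simple_path_join_loop) (auto simp: arc_reversepath)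
  have lp: "pathfinish (c +++ reversepath d) = pathstart (c +++ reversepath d)"
    using d by simp
  note JC = Jordan_inside_outside [OF sp lp, folded J_def]
  have p: "?p \<in> path_image c" "?p \<notin> K" using arc_midpoint [OF c] meet by auto
  then obtain e where e: "e > 0" "ball ?p e \<subseteq> - K"
    using K by (metis ComplI open_Compl open_contains_ball)
  have "?p \<in> closure (inside J)" "?p \<in> closure (outside J)"
    using JC p J by (auto simp: frontier_def)
  then obtain a b where a: "a \<in> inside J" "a \<in> ball ?p e" and b: "b \<in> outside J" "b \<in> ball ?p e"
    using e(1) unfolding closure_approachable mem_ball by (metis dist_commute)
  let ?C = "\<lambda>z. connected_component_set (- (K \<union> path_image c)) z"
  have mem: "a \<in> - (K \<union> path_image c)" "b \<in> - (K \<union> path_image c)"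
  proof -
    have "inside J \<union> outside J = - J" using JC by simp
    then have "a \<notin> J" "b \<notin> J" using a b by blast+
    then show "a \<in> - (K \<union> path_image c)" "b \<in> - (K \<union> path_image c)"
      using J e(2) a(2) b(2) by auto
  qed
  have "?C a \<noteq> ?C b"
  proof
    assume "?C a = ?C b"
    then have "connected_component (- (K \<union> path_image c)) a b"
      by (metis connected_component_eq_eq mem(1) mem(2))
    then have "connected_component (- J) a b"
      by (rule connected_component_of_subset) (use J d in auto)
    then obtain T where T: "connected T" "T \<subseteq> - J" "a \<in> T" "b \<in> T"
      by (auto simp: connected_component_def)
    have "b \<notin> inside J" using b JC by blast
    then have "T \<inter> frontier (inside J) \<noteq> {}"
      using T a by (intro connected_Int_frontier) auto
    then show False using T JC by auto
  qed
  moreover have "?C z \<subseteq> connected_component_set (- K) ?p" if "z \<in> ball ?p e" for z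
  proof -
    have "connected_component (- K) ?p z"
      using e that unfolding connected_component_def by (intro exI [of _ "ball ?p e"]) auto
    then have "connected_component_set (- K) ?p = connected_component_set (- K) z"
      by (simp add: connected_component_eq)
    moreover have "?C z \<subseteq> connected_component_set (- K) z"
      by (intro connected_component_mono) auto
    ultimately show ?thesis by simp
  qed
  ultimately show ?thesis using that [of "?C a" "?C b"] mem a b by (simp add: componentsI)
qed

text \<open>The part of the arc around its midpoint is completed to a Jordan curve inside the complement
  of \<open>K\<close>; locally the complement of the arc is then the complement of this curve, which has two
  sides, and by Janiszewski's theorem points on the same side are not separated by \<open>K\<close> and the arc.\<close>

lemma components_at_midpoint_le_two:
  fixes K :: "complex set"
  assumes K: "closed K" and c: "arc c"
    and meet: "path_image c \<inter> K = {pathstart c, pathfinish c}"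
    and comp: "\<And>i. i \<in> I \<Longrightarrow> i \<in> components (- (K \<union> path_image c)) \<and> c (1/2) \<in> closure i"
  shows "finite I \<and> card I \<le> 2"
proof -
  have inj: "inj_on c {0..1}" and cc: "continuous_on {0..1} c"
    using c by (auto simp: arc_def path_def)
  have ci: "s = t" if "c s = c t" "0 \<le> s" "s \<le> 1" "0 \<le> t" "t \<le> 1" for s t
    using inj_onD [OF inj that(1)] that by auto
  have cK: "c t \<notin> K" if "0 < t" "t < 1" for t
  proof
    assume "c t \<in> K"
    then have "c t = c 0 \<or> c t = c 1"
      using meet that by (auto simp: path_image_def pathstart_def pathfinish_def)
    then show False using inj_onD [OF inj, of t 0] inj_onD [OF inj, of t 1] that by auto
  qed
  have cim: "c ` {s..t} \<inter> K = {}" if "0 < s" "t < 1" for s t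
    using cK that by fastforce
  have arcM: "path_image (subpath (3/8) (5/8) c) = c ` {3/8..5/8}"
    by (simp add: path_image_subpath)
  \<comment> \<open>The detour around the midpoint: the middle piece of \<open>c\<close> and
    \<open>K\<close> are disjoint, and neither separates the two quarter points, so their union does
    not either. The parameters only have to satisfy 0 < 1/4 < 3/8 < 1/2 < 5/8 < 3/4 < 1.\<close>
  have "connected_component (- (path_image (subpath (3/8) (5/8) c) \<union> K)) (c (1/4)) (c (3/4))"
  proof (rule Janiszewski)
    show "compact (path_image (subpath (3/8) (5/8) c))"
      using c by (simp add: arc_imp_path compact_path_image)
    show "closed K" by fact
    have "path_image (subpath (3/8) (5/8) c) \<inter> K = {}"
      unfolding arcM by (rule cim) auto
    then show "connected (path_image (subpath (3/8) (5/8) c) \<inter> K)" by simp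
    have "arc (subpath (3/8) (5/8) c)" using c by (intro arc_subpath_arc) auto
    then have "connected (- path_image (subpath (3/8) (5/8) c))"
      by (intro connected_arc_complement) auto
    moreover have "c (1/4) \<notin> c ` {3/8..5/8}" "c (3/4) \<notin> c ` {3/8..5/8}"
      by (auto dest!: ci)
    ultimately show "connected_component (- path_image (subpath (3/8) (5/8) c)) (c (1/4)) (c (3/4))"
      by (simp add: arcM connected_iff_connected_component)
    have "connected (c ` {1/4..3/4})"
      by (intro connected_continuous_image continuous_on_subset [OF cc]) auto
    then show "connected_component (- K) (c (1/4)) (c (3/4))"
      unfolding connected_component_def
      using cim [of "1/4" "3/4"] by (intro exI [of _ "c ` {1/4..3/4}"]) auto
  qed
  then have "path_component (- (c ` {3/8..5/8} \<union> K)) (c (1/4)) (c (3/4))"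
    using K c unfolding arcM
    by (subst open_path_connected_component)
       (auto intro!: open_Compl closed_Un compact_imp_closed compact_continuous_image continuous_on_subset [OF cc])
  then obtain h where h: "path h" "path_image h \<subseteq> - (c ` {3/8..5/8} \<union> K)" "pathstart h = c (1/4)" "pathfinish h = c (3/4)"
    by (auto simp: path_component_def)
  have "c (1/4) \<noteq> c (3/4)" by (auto dest!: ci)
  then obtain d where "arc d" "path_image d \<subseteq> path_image h" "pathstart d = c (1/4)" "pathfinish d = c (3/4)"
    by (rule path_contains_arc [OF h(1,3,4)])
  with h(2) have d: "arc d" "path_image d \<subseteq> - (c ` {3/8..5/8} \<union> K)" "d 0 = c (1/4)" "d 1 = c (3/4)"
    by (auto simp: pathstart_def pathfinish_def)
  have cd: "continuous_on {0..1} d" and injd: "inj_on d {0..1}" using d(1) by (auto simp: arc_def path_def)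
  have dK: "d t \<notin> K" "d t \<notin> c ` {3/8..5/8}" if "t \<in> {0..1}" for t
    using d(2) that unfolding path_image_def by blast+
  \<comment> \<open>cut \<open>d\<close> down to a subarc that meets \<open>c\<close> in its endpoints only, one on each side of the midpoint\<close>
  define X where "X = {t \<in> {0..1}. d t \<in> c ` {0..3/8}}"
  have clc: "closed (c ` {s..t})" if "0 \<le> s" "t \<le> 1" for s t
    using that by (intro compact_imp_closed compact_continuous_image continuous_on_subset [OF cc]) auto
  have "compact X"
  proof -
    have "closed ({0..1} \<inter> d -` (c ` {0..3/8}))"
      by (rule continuous_closed_preimage [OF cd]) (auto intro: clc)
    moreover have "X = {0..1} \<inter> d -` (c ` {0..3/8})" by (auto simp: X_def)
    ultimately show ?thesis by (metis compact_Int_closed compact_Icc inf_assoc inf_idem)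
  qed
  moreover have "0 \<in> X" using d(3) by (auto simp: X_def)
  ultimately obtain u where u: "u \<in> X" "\<And>t. t \<in> X \<Longrightarrow> t \<le> u"
    using compact_attains_sup [of X] by auto
  define Y where "Y = {t \<in> {u..1}. d t \<in> c ` {5/8..1}}"
  have u01: "0 \<le> u" "u \<le> 1" using u(1) by (auto simp: X_def)
  have "compact Y"
  proof -
    have "closed ({u..1} \<inter> d -` (c ` {5/8..1}))"
      by (rule continuous_closed_preimage [OF continuous_on_subset [OF cd]]) (use u01 in \<open>auto intro: clc\<close>)
    moreover have "Y = {u..1} \<inter> d -` (c ` {5/8..1})" by (auto simp: Y_def)
    ultimately show ?thesis by (metis compact_Int_closed compact_Icc inf_assoc inf_idem)
  qed
  moreover have "1 \<in> Y" using d(4) u01 by (auto simp: Y_def)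
  ultimately obtain v where v: "v \<in> Y" "\<And>t. t \<in> Y \<Longrightarrow> v \<le> t"
    using compact_attains_inf [of Y] by auto
  obtain a where a: "d u = c a" "0 \<le> a" "a \<le> 3/8" using u(1) by (auto simp: X_def)
  obtain b where b: "d v = c b" "5/8 \<le> b" "b \<le> 1" using v(1) by (auto simp: Y_def)
  have uv: "u \<le> v" "v \<le> 1" using v(1) by (auto simp: Y_def)
  have "a \<noteq> 3/8" "b \<noteq> 5/8" using dK [of u] dK [of v] a b u01 uv by auto
  then have a': "a < 3/8" and b': "5/8 < b" using a b by auto
  have "a \<noteq> 0" "b \<noteq> 1"
    using dK [of u] dK [of v] a b u01 uv meet by (auto simp: pathstart_def pathfinish_def)
  then have ab: "0 < a" "b < 1" using a b by auto
  have "u \<noteq> v" using a b inj_onD [OF inj, of a b] by auto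
  then have uv': "u < v" using uv by auto
  have only: "t = u \<or> t = v" if t: "t \<in> {u..v}" "d t \<in> path_image c" for t
  proof -
    obtain s where s: "d t = c s" "0 \<le> s" "s \<le> 1" using t(2) by (auto simp: path_image_def)
    consider "s \<le> 3/8" | "s \<in> {3/8..5/8}" | "5/8 \<le> s" by fastforce
    then show ?thesis
    proof cases
      case 1
      then have "t \<in> X" using s that u01 uv by (auto simp: X_def)
      then show ?thesis using u(2) that(1) by fastforce
    next
      case 2
      then show ?thesis using dK [of t] s that u01 uv by auto
    next
      case 3
      then have "t \<in> Y" using s that u01 uv by (auto simp: Y_def)
      then show ?thesis using v(2) that(1) by fastforce
    qed
  qed
  define d' where "d' = subpath u v d"
  define c' where "c' = subpath b a c"
  have imd: "path_image d' = d ` {u..v}" using uv by (simp add: d'_def path_image_subpath)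
  have imc: "path_image c' = c ` {a..b}" using a' b' by (simp add: c'_def path_image_subpath)
  have dc: "path_image d' \<inter> path_image c \<subseteq> {c a, c b}"
  proof
    fix z assume "z \<in> path_image d' \<inter> path_image c"
    then obtain t where "t \<in> {u..v}" "z = d t" "d t \<in> path_image c" by (auto simp: imd)
    then show "z \<in> {c a, c b}" using only [of t] a(1) b(1) by auto
  qed
  have cc': "path_image c' \<subseteq> path_image c"
    unfolding imc path_image_def [of c] using a b by (intro image_mono) auto
  have arcd: "arc d'" unfolding d'_def using d(1) u01 uv uv' by (intro arc_subpath_arc) auto
  have arcc: "arc c'" unfolding c'_def using c a b a' b' by (intro arc_subpath_arc) auto
  have ends: "pathstart d' = c a" "pathfinish d' = c b" "pathstart c' = c b" "pathfinish c' = c a"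
    using a b by (auto simp: d'_def c'_def)
  define J where "J = path_image (d' +++ c')"
  have sp: "simple_path (d' +++ c')"
    using arcc arcd ends dc cc' by (intro simple_path_join_loop) auto
  have lp: "pathfinish (d' +++ c') = pathstart (d' +++ c')" using ends by simp
  note JC = Jordan_inside_outside [OF sp lp, folded J_def]
  have J: "J = path_image d' \<union> c ` {a..b}"
    unfolding J_def using ends imc by (simp add: path_image_join)
  \<comment> \<open>\<open>J\<close> and \<open>Z\<close> together cover \<open>K\<close> and the
    whole arc. Putting the detour \<open>d'\<close> into both makes their intersection exactly
    \<open>d'\<close>, which is connected, as Janiszewski's theorem requires.\<close>
  define Z where "Z = K \<union> c ` {0..a} \<union> c ` {b..1} \<union> path_image d'"
  have clZ: "closed Z"
    unfolding Z_def using K ab a' b' arcd by (intro closed_Un clc) (auto intro: closed_arc_image)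
  have cZ: "path_image c = c ` {0..a} \<union> c ` {a..b} \<union> c ` {b..1}"
  proof -
    have "{0..1} = {0..a} \<union> {a..b} \<union> {b..1}" using ab a' b' by auto
    then show ?thesis by (simp add: path_image_def image_Un)
  qed
  have "c (1/2) \<notin> Z"
  proof
    assume "c (1/2) \<in> Z"
    moreover have "c (1/2) \<notin> K" using cK by auto
    moreover have "c (1/2) \<notin> c ` {0..a}" "c (1/2) \<notin> c ` {b..1}"
      using ab a' b' by (auto dest!: ci)
    ultimately have "c (1/2) \<in> path_image d'" by (auto simp: Z_def)
    then have "c (1/2) \<in> {c a, c b}" using dc arc_midpoint(1) [OF c] by blast
    then show False using inj_onD [OF inj, of "1/2" a] inj_onD [OF inj, of "1/2" b] ab a' b' by auto
  qed
  then obtain e where e: "e > 0" "ball (c (1/2)) e \<subseteq> - Z"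
    using clZ by (metis ComplI open_Compl open_contains_ball)
  have "\<exists>z. z \<in> i \<and> z \<in> ball (c (1/2)) e" if "i \<in> I" for i
    using comp [OF that] e(1) by (auto simp: closure_approachable dist_commute)
  then obtain z where z: "\<And>i. i \<in> I \<Longrightarrow> z i \<in> i" "\<And>i. i \<in> I \<Longrightarrow> z i \<in> ball (c (1/2)) e"
    by metis
  have zKc: "z i \<notin> K \<union> path_image c" if "i \<in> I" for i
    using comp [OF that] z(1) [OF that] in_components_subset by blast
  have zJ: "z i \<in> inside J \<or> z i \<in> outside J" if "i \<in> I" for i
  proof -
    have "z i \<notin> J" using zKc [OF that] z(2) [OF that] e(2) J cZ by (auto simp: Z_def)
    then show ?thesis using JC by blast
  qed
  \<comment> \<open>Two sample points on one side of \<open>J\<close> are joined off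
    \<open>J\<close> by that side and off \<open>Z\<close> by the disc around the midpoint, hence
    off the union, so they lie in the same component. Sending \<open>i\<close> to the side of
    \<open>z i\<close> is therefore injective.\<close>
  have same: "i = j" if ij: "i \<in> I" "j \<in> I" and S: "connected S" "S \<subseteq> - J" "z i \<in> S" "z j \<in> S" for i j S
  proof -
    have "connected_component (- (J \<union> Z)) (z i) (z j)"
    proof (rule Janiszewski)
      show "compact J" unfolding J_def using sp by (simp add: compact_simple_path_image)
      show "closed Z" by fact
      have "J \<inter> Z = path_image d'"
      proof
        show "path_image d' \<subseteq> J \<inter> Z" by (auto simp: J Z_def)
        have "c ` {a..b} \<inter> K = {}" using cim ab by auto
        moreover have "c ` {a..b} \<inter> c ` {0..a} \<subseteq> {c a}" "c ` {a..b} \<inter> c ` {b..1} \<subseteq> {c b}"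
          using ab a' b' by (auto dest!: ci)
        moreover have "c a \<in> path_image d'" "c b \<in> path_image d'"
          using ends by (metis pathstart_in_path_image, metis pathfinish_in_path_image)
        moreover have "(D \<union> C) \<inter> (K \<union> A \<union> B \<union> D) \<subseteq> D"
          if "C \<inter> K = {}" "C \<inter> A \<subseteq> {p}" "C \<inter> B \<subseteq> {q}" "p \<in> D" "q \<in> D"
          for A B C D :: "complex set" and p q
          using that by blast
        ultimately show "J \<inter> Z \<subseteq> path_image d'" unfolding J Z_def by metis
      qed
      then show "connected (J \<inter> Z)" using arcd by (simp add: connected_arc_image)
      show "connected_component (- J) (z i) (z j)" using S by (auto simp: connected_component_def)
      show "connected_component (- Z) (z i) (z j)"
        unfolding connected_component_def using e z(2) ij by (intro exI [of _ "ball (c (1/2)) e"]) auto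
    qed
    then have "connected_component (- (K \<union> path_image c)) (z i) (z j)"
      by (rule connected_component_of_subset) (use cZ J in \<open>auto simp: Z_def\<close>)
    then obtain T where "connected T" "T \<subseteq> - (K \<union> path_image c)" "z i \<in> T" "z j \<in> T"
      by (auto simp: connected_component_def)
    moreover have "i \<inter> T \<noteq> {}" "j \<inter> T \<noteq> {}" using calculation z(1) ij by auto
    ultimately show "i = j"
      using comp ij joinable_components_eq [of T "- (K \<union> path_image c)" i j] by simp
  qed
  have io: "connected (inside J)" "connected (outside J)" "inside J \<subseteq> - J" "outside J \<subseteq> - J"
    using JC by blast+
  define f where "f i = (z i \<in> inside J)" for i
  have "inj_on f I"
  proof (rule inj_onI)
    fix i j assume ij: "i \<in> I" "j \<in> I" "f i = f j"
    show "i = j"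
    proof (cases "z i \<in> inside J")
      case True
      then show ?thesis using ij io by (intro same [of i j "inside J"]) (auto simp: f_def)
    next
      case False
      then show ?thesis using ij io zJ by (intro same [of i j "outside J"]) (auto simp: f_def)
    qed
  qed
  then have "finite I" "card I \<le> card (UNIV :: bool set)"
    by (metis finite_imageD finite_subset finite top_greatest, metis card_inj_on_le finite subset_UNIV)
  then show ?thesis by simp
qed

text \<open>Otherwise a nonempty open subset of the plane would embed into the real line,
  contradicting invariance of dimension.\<close>

lemma interior_arc_image_empty:
  fixes c :: "real \<Rightarrow> complex"
  assumes "arc c"
  shows "interior (path_image c) = {}"
proof (rule ccontr)
  assume ne: "interior (path_image c) \<noteq> {}"
  have "path_image c homeomorphic {0..1::real}"
    using homeomorphic_arc_image_interval [OF assms, of 0 1] by simp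
  then obtain f g where "homeomorphism (path_image c) {0..1::real} f g"
    by (auto simp: homeomorphic_def)
  then have "continuous_on (interior (path_image c)) f" "inj_on f (interior (path_image c))"
    using interior_subset [of "path_image c"]
    by (auto simp: homeomorphism_def inj_on_def elim: continuous_on_subset) (metis subsetD)
  then have "DIM(complex) \<le> DIM(real)"
    using ne by (intro invariance_of_dimension [where f = f and S = "interior (path_image c)"]) auto
  then show False by simp
qed

lemma connected_planar_arc_complement:
  fixes c :: "real \<Rightarrow> complex"
  shows "arc c \<Longrightarrow> connected (- path_image c)"
  by (rule connected_arc_complement) simp_all

text \<open>An open face cannot be covered by an arc, whose interior is empty, so part of it
  survives. Drawing an edge thus never makes a face disappear.\<close>

lemma component_avoiding_arc:
  fixes K :: "complex set"
  assumes "closed K" "arc c" "F \<in> components (- K)"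
  shows "\<exists>G \<in> components (- (K \<union> path_image c)). G \<subseteq> F"
proof -
  have "open F" "F \<noteq> {}" "F \<subseteq> - K"
    using open_components [OF open_Compl [OF assms(1)] assms(3)] in_components_nonempty [OF assms(3)]
      in_components_subset [OF assms(3)] by simp_all
  have "interior (path_image c) = {}" using assms(2) by (rule interior_arc_image_empty)
  then have "\<not> F \<subseteq> path_image c"
    using \<open>open F\<close> \<open>F \<noteq> {}\<close> interior_maximal by blast
  then obtain z where z: "z \<in> F" "z \<notin> path_image c" by auto
  let ?G = "connected_component_set (- (K \<union> path_image c)) z"
  have "z \<in> - (K \<union> path_image c)" using z \<open>F \<subseteq> - K\<close> by auto
  then have G: "?G \<in> components (- (K \<union> path_image c))" "z \<in> ?G" by (auto intro: componentsI)
  have "?G \<subseteq> F"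
  proof (rule components_maximal [OF assms(3)])
    show "?G \<subseteq> - K" using in_components_subset [OF G(1)] by auto
    show "F \<inter> ?G \<noteq> {}" using z G by auto
  qed simp
  with G show ?thesis by auto
qed

text \<open>The pieces are added one at a time. A piece meets the base and all other pieces in the
  same point \<open>q\<close> at most, so its intersection with what is present already is empty or
  a single point, whatever the order, and Janiszewski's theorem keeps the complement
  connected.\<close>

lemma connected_complement_UN:
  fixes B :: "complex set"
  assumes "finite J" "compact B" "connected (- B)"
    and P: "\<And>j. j \<in> J \<Longrightarrow> compact (P j) \<and> connected (- P j)"
    and meet: "\<And>j. j \<in> J \<Longrightarrow> \<exists>q. P j \<inter> B \<subseteq> {q} \<and> (\<forall>i \<in> J - {j}. P j \<inter> P i \<subseteq> {q})"
  shows "connected (- (B \<union> (\<Union>j\<in>J. P j)))"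
proof -
  have "J' \<subseteq> J \<Longrightarrow> connected (- (B \<union> (\<Union>j\<in>J'. P j)))" if "finite J'" for J'
    using that
  proof (induction J')
    case empty
    then show ?case using assms by simp
  next
    case (insert j J')
    then have j: "j \<in> J" "J' \<subseteq> J" "j \<notin> J'" by auto
    obtain q where q: "P j \<inter> B \<subseteq> {q}" "\<forall>i \<in> J - {j}. P j \<inter> P i \<subseteq> {q}" using meet [OF j(1)] by auto
    let ?U = "B \<union> (\<Union>j\<in>J'. P j)"
    have "P j \<inter> ?U \<subseteq> {q}" using q j by blast
    then have "P j \<inter> ?U = {} \<or> P j \<inter> ?U = {q}" by (rule subset_singletonD)
    then have con: "connected (P j \<inter> ?U)" by auto
    have "compact ?U"
      using assms(2) P j insert.hyps by (intro compact_Un compact_UN) auto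
    then have "connected (- (P j \<union> ?U))"
      using P [OF j(1)] insert.IH [OF j(2)] con
      by (intro Janiszewski_connected [of "P j" ?U]) (blast intro: compact_imp_closed)+
    moreover have "P j \<union> ?U = B \<union> (\<Union>j\<in>insert j J'. P j)" by auto
    ultimately show ?case by simp
  qed
  then show ?thesis using assms(1) by blast
qed

section \<open>Drawn edge sets and combinatorial connectivity\<close>

text \<open>All vertices are present from the start, so that an induction over the edges adds
  nothing but arcs.\<close>

definition drawn :: "'a set \<Rightarrow> ('a \<Rightarrow> complex) \<Rightarrow> ('a set \<Rightarrow> real \<Rightarrow> complex) \<Rightarrow> 'a set set \<Rightarrow> complex set" where
  "drawn V pos \<gamma> F = pos ` V \<union> (\<Union>e\<in>F. path_image (\<gamma> e))"

text \<open>This is an equivalence on the whole type; the components of the graph are counted as the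
  classes of the elements of \<open>V\<close>.\<close>

definition connectivity :: "'a set set \<Rightarrow> ('a \<times> 'a) set" where
  "connectivity F = {(u, v). {u, v} \<in> F}\<^sup>*"

lemma sym_connectivity: "(u, v) \<in> connectivity F \<Longrightarrow> (v, u) \<in> connectivity F"
proof -
  have "sym {(u, v). {u, v} \<in> F}" by (auto simp: sym_def insert_commute)
  then show "(u, v) \<in> connectivity F \<Longrightarrow> (v, u) \<in> connectivity F"
    unfolding connectivity_def by (metis sym_rtrancl symD)
qed

lemma trans_connectivity:
  "(u, v) \<in> connectivity F \<Longrightarrow> (v, w) \<in> connectivity F \<Longrightarrow> (u, w) \<in> connectivity F"
  unfolding connectivity_def by (rule rtrancl_trans)

lemma connectivity_refl [simp]: "(u, u) \<in> connectivity F"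
  by (simp add: connectivity_def)

lemma connectivity_insert_redundant:
  assumes "(a, b) \<in> connectivity F"
  shows "connectivity (insert {a, b} F) = connectivity F"
proof -
  have "{(u, v). {u, v} \<in> insert {a, b} F} \<subseteq> connectivity F"
    using assms sym_connectivity [OF assms] by (auto simp: doubleton_eq_iff connectivity_def)
  then show ?thesis unfolding connectivity_def
    by (intro rtrancl_subset) auto
qed

lemma card_connectivity_classes_insert:
  assumes "finite V" "a \<in> V" "b \<in> V" "(a, b) \<notin> connectivity F"
  shows "card ((\<lambda>v. connectivity (insert {a, b} F) `` {v}) ` V) < card ((\<lambda>v. connectivity F `` {v}) ` V)"
proof -
  let ?F = "insert {a, b} F"
  let ?c = "\<lambda>v. connectivity F `` {v}" and ?d = "\<lambda>v. connectivity ?F `` {v}"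
  have mono: "connectivity F \<subseteq> connectivity ?F"
    unfolding connectivity_def by (rule rtrancl_mono) auto
  have dc: "?d v = connectivity ?F `` ?c v" for v
    using mono trans_connectivity [of _ _ ?F] connectivity_refl [of v F] by blast
  have ab: "(a, b) \<in> connectivity ?F" by (auto simp: connectivity_def)
  then have dab: "?d a = ?d b"
    using trans_connectivity [OF ab] trans_connectivity [OF sym_connectivity [OF ab]] by blast
  have "?c a \<noteq> ?c b" using assms(4) connectivity_refl [of b F] by blast
  have "?d ` V \<subseteq> (\<lambda>X. connectivity ?F `` X) ` (?c ` V - {?c b})"
  proof
    fix X assume "X \<in> ?d ` V"
    then obtain v where v: "v \<in> V" "X = ?d v" by auto
    show "X \<in> (\<lambda>X. connectivity ?F `` X) ` (?c ` V - {?c b})"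
    proof (cases "?c v = ?c b")
      case True
      then have "X = connectivity ?F `` ?c a" using v(2) dc dab by metis
      then show ?thesis using assms(2) \<open>?c a \<noteq> ?c b\<close> by blast
    next
      case False
      then show ?thesis using v dc [of v] by blast
    qed
  qed
  then have "card (?d ` V) \<le> card (?c ` V - {?c b})"
    using assms(1) by (intro surj_card_le) auto
  also have "\<dots> < card (?c ` V)"
    using assms by (intro card_Diff1_less) auto
  finally show ?thesis .
qed

section \<open>Plane graphs and Euler's inequality\<close>

locale plane_graph =
  fixes V :: "'a set" and E :: "'a set set" and pos :: "'a \<Rightarrow> complex" and \<gamma> :: "'a set \<Rightarrow> real \<Rightarrow> complex"
  assumes simple: "simple_graph V E" and drawing: "plane_drawing V E pos \<gamma>"
begin

lemma finite_vertices: "finite V" and edgeD: "e \<in> E \<Longrightarrow> e \<subseteq> V" "e \<in> E \<Longrightarrow> card e = 2"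
  using simple by (auto simp: simple_graph_def)

lemma finite_edges: "finite E"
  using finite_subset [of E "Pow V"] finite_vertices edgeD by auto

lemma arc_edge: "e \<in> E \<Longrightarrow> arc (\<gamma> e)"
  using drawing by (simp add: plane_drawing_def)

lemma edge_ends: "e \<in> E \<Longrightarrow> {pathstart (\<gamma> e), pathfinish (\<gamma> e)} = pos ` e"
  using drawing by (simp add: plane_drawing_def)

lemma edge_interior:
  assumes "e \<in> E" "z \<in> path_image (\<gamma> e)" "z \<noteq> pathstart (\<gamma> e)" "z \<noteq> pathfinish (\<gamma> e)"
  shows "z \<notin> pos ` V" "f \<in> E \<Longrightarrow> f \<noteq> e \<Longrightarrow> z \<notin> path_image (\<gamma> f)"
proof -
  have z: "z \<in> path_image (\<gamma> e) - pos ` e" using assms edge_ends [OF assms(1)] by blast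
  have "(path_image (\<gamma> e) - pos ` e) \<inter> pos ` V = {}"
    using drawing assms(1) by (simp add: plane_drawing_def)
  then show "z \<notin> pos ` V" using z by blast
  have "(path_image (\<gamma> e) - pos ` e) \<inter> path_image (\<gamma> f) = {}" if "f \<in> E" "f \<noteq> e"
    using drawing assms(1) that unfolding plane_drawing_def by blast
  then show "f \<in> E \<Longrightarrow> f \<noteq> e \<Longrightarrow> z \<notin> path_image (\<gamma> f)" using z by blast
qed

lemma compact_drawn: "F \<subseteq> E \<Longrightarrow> compact (drawn V pos \<gamma> F)"
  unfolding drawn_def using finite_vertices finite_subset [OF _ finite_edges] arc_edge
  by (intro compact_Un compact_UN) (auto intro: compact_arc_image finite_imp_compact)

lemma closed_drawn: "F \<subseteq> E \<Longrightarrow> closed (drawn V pos \<gamma> F)"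
  using compact_drawn compact_imp_closed by blast

lemma drawn_insert: "drawn V pos \<gamma> (insert e F) = drawn V pos \<gamma> F \<union> path_image (\<gamma> e)"
  by (auto simp: drawn_def)

lemma edge_Int_drawn:
  assumes "e \<in> E" "F \<subseteq> E" "e \<notin> F"
  shows "path_image (\<gamma> e) \<inter> drawn V pos \<gamma> F = {pathstart (\<gamma> e), pathfinish (\<gamma> e)}"
proof
  show "path_image (\<gamma> e) \<inter> drawn V pos \<gamma> F \<subseteq> {pathstart (\<gamma> e), pathfinish (\<gamma> e)}"
  proof
    fix z assume z: "z \<in> path_image (\<gamma> e) \<inter> drawn V pos \<gamma> F"
    show "z \<in> {pathstart (\<gamma> e), pathfinish (\<gamma> e)}"
    proof (rule ccontr)
      assume "z \<notin> {pathstart (\<gamma> e), pathfinish (\<gamma> e)}"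
      then have "z \<notin> pos ` V" "\<And>f. f \<in> E \<Longrightarrow> f \<noteq> e \<Longrightarrow> z \<notin> path_image (\<gamma> f)"
        using edge_interior [OF assms(1)] z by auto
      then show False using z assms by (auto simp: drawn_def)
    qed
  qed
  have "{pathstart (\<gamma> e), pathfinish (\<gamma> e)} \<subseteq> pos ` V"
    using edge_ends [OF assms(1)] edgeD(1) [OF assms(1)] by blast
  then show "{pathstart (\<gamma> e), pathfinish (\<gamma> e)} \<subseteq> path_image (\<gamma> e) \<inter> drawn V pos \<gamma> F"
    by (auto simp: drawn_def)
qed

lemma edge_path_component:
  assumes "e \<in> F" "F \<subseteq> E" "u \<in> e" "v \<in> e"
  shows "path_component (drawn V pos \<gamma> F) (pos u) (pos v)"
proof -
  have e: "e \<in> E" using assms by auto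
  have sub: "path_image (\<gamma> e) \<subseteq> drawn V pos \<gamma> F" using assms by (auto simp: drawn_def)
  have "pos ` e \<subseteq> path_image (\<gamma> e)" using edge_ends [OF e] by (metis insert_subset empty_subsetI pathstart_in_path_image pathfinish_in_path_image)
  moreover have "path_connected (path_image (\<gamma> e))"
    using arc_edge [OF e] by (simp add: arc_imp_path path_connected_path_image)
  ultimately have "path_component (path_image (\<gamma> e)) (pos u) (pos v)"
    using assms unfolding path_connected_component by blast
  then show ?thesis using sub path_component_of_subset by blast
qed

text \<open>This supplies the hypothesis of \<open>arc_splits_component\<close> when an edge closes
  a cycle.\<close>

lemma connectivity_path_component:
  assumes "(u, v) \<in> connectivity F" "F \<subseteq> E" "u \<in> V"
  shows "path_component (drawn V pos \<gamma> F) (pos u) (pos v)"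
  using assms(1) unfolding connectivity_def
proof (induction rule: rtrancl_induct)
  case base
  show ?case using assms(3) by (simp add: path_component_refl drawn_def)
next
  case (step v w)
  then show ?case
    using edge_path_component [of "{v, w}" F v w] assms(2) by (auto intro: path_component_trans)
qed

text \<open>Half of Euler's formula: drawing one more edge either connects two components of the graph
  or, closing a cycle, splits a face.\<close>

lemma euler_faces:
  assumes "F \<subseteq> E"
  shows "\<exists>\<F> \<subseteq> components (- drawn V pos \<gamma> F). finite \<F> \<and>
    card F + card ((\<lambda>v. connectivity F `` {v}) ` V) + 1 \<le> card V + card \<F>"
  using finite_subset [OF assms finite_edges] assms
proof (induction F)
  \<comment> \<open>Only some finite family of faces is tracked: \<open>card\<close> of an infinite
    set is 0, and this form needs no proof that the number of faces is finite. Without edges a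
    single face suffices.\<close>
  case empty
  have "finite (drawn V pos \<gamma> {})" using finite_vertices by (simp add: drawn_def)
  then have "- drawn V pos \<gamma> {} \<noteq> {}"
    using infinite_UNIV_char_0 [where 'a = complex] by (metis Compl_empty_eq double_complement)
  then obtain C where "C \<in> components (- drawn V pos \<gamma> {})" by (metis components_eq_empty all_not_in_conv)
  moreover have "card ((\<lambda>v. connectivity {} `` {v}) ` V) \<le> card V"
    using finite_vertices by (rule card_image_le)
  ultimately show ?case by (intro exI [of _ "{C}"]) auto
next
  case (insert e F)
  then have e: "e \<in> E" "e \<notin> F" "F \<subseteq> E" "finite F" by auto
  let ?K = "drawn V pos \<gamma> F" and ?c = "\<gamma> e"
  have K: "closed ?K" using closed_drawn e by simp
  have c: "arc ?c" using arc_edge e by simp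
  obtain \<F> where \<F>: "\<F> \<subseteq> components (- ?K)" "finite \<F>"
    "card F + card ((\<lambda>v. connectivity F `` {v}) ` V) + 1 \<le> card V + card \<F>"
    using insert.IH [OF e(3)] by blast
  have "\<forall>f\<in>\<F>. \<exists>G \<in> components (- (?K \<union> path_image ?c)). G \<subseteq> f"
    using component_avoiding_arc [OF K c] \<F>(1) by blast
  \<comment> \<open>\<open>h\<close> picks a surviving part of each old face. It is injective
    because different faces are disjoint.\<close>
  then obtain h where h: "\<And>f. f \<in> \<F> \<Longrightarrow> h f \<in> components (- (?K \<union> path_image ?c))" "\<And>f. f \<in> \<F> \<Longrightarrow> h f \<subseteq> f"
    by metis
  have hne: "h f \<noteq> {}" if "f \<in> \<F>" for f using h(1) [OF that] by (rule in_components_nonempty)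
  have inj: "inj_on h \<F>"
  proof (rule inj_onI)
    fix f g assume fg: "f \<in> \<F>" "g \<in> \<F>" "h f = h g"
    then have "f \<inter> g \<noteq> {}" using h(2) hne by blast
    then show "f = g" using components_eq \<F>(1) fg by blast
  qed
  have dr: "drawn V pos \<gamma> (insert e F) = ?K \<union> path_image ?c" by (rule drawn_insert)
  obtain a b where ab: "e = {a, b}" "a \<noteq> b" "a \<in> V" "b \<in> V"
    using edgeD [OF e(1)] by (auto simp: card_2_iff)
  show ?case
  proof (cases "(a, b) \<in> connectivity F")
    case False
    have "card ((\<lambda>v. connectivity (insert e F) `` {v}) ` V) < card ((\<lambda>v. connectivity F `` {v}) ` V)"
      unfolding ab(1) by (rule card_connectivity_classes_insert [OF finite_vertices ab(3,4) False])
    moreover have "card (h ` \<F>) = card \<F>" using inj by (rule card_image)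
    ultimately have "card (insert e F) + card ((\<lambda>v. connectivity (insert e F) `` {v}) ` V) + 1 \<le> card V + card (h ` \<F>)"
      using \<F>(3) e by simp
    moreover have "h ` \<F> \<subseteq> components (- drawn V pos \<gamma> (insert e F))" unfolding dr using h(1) by blast
    ultimately show ?thesis using \<F>(2) by blast
  next
    case True
    have "path_component ?K (pos a) (pos b)"
      using connectivity_path_component [OF True e(3) ab(3)] .
    moreover have "{pathstart ?c, pathfinish ?c} = {pos a, pos b}" using edge_ends [OF e(1)] ab(1) by simp
    ultimately have pc: "path_component ?K (pathstart ?c) (pathfinish ?c)"
      by (auto simp: doubleton_eq_iff intro: path_component_sym)
    have meet: "path_image ?c \<inter> ?K \<subseteq> {pathstart ?c, pathfinish ?c}"
      using edge_Int_drawn [OF e(1,3,2)] by simp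
    obtain C D where CD: "C \<in> components (- (?K \<union> path_image ?c))" "D \<in> components (- (?K \<union> path_image ?c))"
      "C \<noteq> D" "C \<subseteq> connected_component_set (- ?K) (?c (1/2))" "D \<subseteq> connected_component_set (- ?K) (?c (1/2))"
      by (rule arc_splits_component [OF K c pc meet])
    let ?f = "connected_component_set (- ?K) (?c (1/2))"
    have CD_ne: "C \<noteq> {}" "D \<noteq> {}" using CD in_components_nonempty by auto
    have "?c (1/2) \<in> - ?K" using CD(4) CD_ne(1) by (metis connected_component_eq_empty subset_empty)
    then have f: "?f \<in> components (- ?K)" by (rule componentsI)
    have notin: "X \<notin> h ` (\<F> - {?f})" if X: "X \<subseteq> ?f" "X \<noteq> {}" for X
    proof
      assume "X \<in> h ` (\<F> - {?f})"
      then obtain g where g: "g \<in> \<F>" "g \<noteq> ?f" "X \<subseteq> g" using h(2) by auto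
      then have "g \<inter> ?f = {}" using components_nonoverlap \<F>(1) f by blast
      then show False using X g by blast
    qed
    \<comment> \<open>The face containing the interior of the new edge is replaced by two of its
      parts. It may be absent from \<open>\<F>\<close>; then nothing is removed and the family gains
      two members instead of one.\<close>
    define \<G> where "\<G> = insert C (insert D (h ` (\<F> - {?f})))"
    have "card (h ` (\<F> - {?f})) = card (\<F> - {?f})"
      using inj by (intro card_image) (auto simp: inj_on_def)
    moreover have "card \<G> = Suc (Suc (card (h ` (\<F> - {?f}))))"
      unfolding \<G>_def using \<F>(2) CD(3) notin [OF CD(4) CD_ne(1)] notin [OF CD(5) CD_ne(2)] by simp
    moreover have "card \<F> \<le> Suc (card (\<F> - {?f}))"
      unfolding card_Diff_singleton_if by (cases "?f \<in> \<F>"; simp only: if_True if_False simp_thms; linarith)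
    ultimately have "Suc (card \<F>) \<le> card \<G>" by simp
    moreover have "connectivity (insert e F) = connectivity F"
      unfolding ab(1) by (rule connectivity_insert_redundant [OF True])
    ultimately have "card (insert e F) + card ((\<lambda>v. connectivity (insert e F) `` {v}) ` V) + 1 \<le> card V + card \<G>"
      using \<F>(3) e by simp
    moreover have "\<G> \<subseteq> components (- drawn V pos \<gamma> (insert e F))"
      unfolding dr \<G>_def using h(1) CD by blast
    moreover have "finite \<G>" unfolding \<G>_def using \<F>(2) by simp
    ultimately show ?thesis by blast
  qed
qed

lemma edge_inj: "e \<in> E \<Longrightarrow> \<gamma> e s = \<gamma> e t \<Longrightarrow> s \<in> {0..1} \<Longrightarrow> t \<in> {0..1} \<Longrightarrow> s = t"
  using arc_edge unfolding arc_def by (blast dest: inj_onD)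

lemma edge_interior_point:
  assumes "e \<in> E" "0 < t" "t < 1"
  shows "\<gamma> e t \<notin> pos ` V" "f \<in> E \<Longrightarrow> f \<noteq> e \<Longrightarrow> \<gamma> e t \<notin> path_image (\<gamma> f)"
proof -
  have "\<gamma> e t \<noteq> pathstart (\<gamma> e)" "\<gamma> e t \<noteq> pathfinish (\<gamma> e)" "\<gamma> e t \<in> path_image (\<gamma> e)"
    using edge_inj [OF assms(1), of t 0] edge_inj [OF assms(1), of t 1] assms
    by (auto simp: pathstart_def pathfinish_def path_image_def)
  then show "\<gamma> e t \<notin> pos ` V" "f \<in> E \<Longrightarrow> f \<noteq> e \<Longrightarrow> \<gamma> e t \<notin> path_image (\<gamma> f)"
    using edge_interior [OF assms(1)] by auto
qed

text \<open>The arcs can meet only in common endpoints, and two different two-element sets share at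
  most one element.\<close>

lemma two_edges_meet:
  assumes "e \<in> E" "f \<in> E" "e \<noteq> f"
  obtains q where "path_image (\<gamma> e) \<inter> path_image (\<gamma> f) \<subseteq> {q}"
proof -
  have "path_image (\<gamma> e) \<inter> path_image (\<gamma> f) \<subseteq> pos ` e \<inter> pos ` f"
    using edge_interior(2) [of e _ f] edge_interior(2) [of f _ e] edge_ends [of e] edge_ends [of f] assms
    by blast
  also have "\<dots> = pos ` (e \<inter> f)"
    using drawing edgeD(1) assms by (intro inj_on_image_Int [symmetric]) (auto simp: plane_drawing_def)
  finally have sub: "path_image (\<gamma> e) \<inter> path_image (\<gamma> f) \<subseteq> pos ` (e \<inter> f)" .
  obtain u v where uv: "e = {u, v}" "u \<noteq> v" using edgeD(2) [OF assms(1)] by (auto simp: card_2_iff)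
  obtain w z where wz: "f = {w, z}" "w \<noteq> z" using edgeD(2) [OF assms(2)] by (auto simp: card_2_iff)
  have "\<exists>p. e \<inter> f \<subseteq> {p}" using assms(3) unfolding uv wz by (auto simp: doubleton_eq_iff)
  then show ?thesis using that sub by blast
qed

text \<open>If at most two edges were seen from a face, its frontier would lie in a forest of arcs --
  those two edges, the vertices, and stubs of the other edges -- and such a set does not separate
  the plane.\<close>

lemma face_incident_edges:
  assumes "3 \<le> card E" and f: "f \<in> components (- drawn V pos \<gamma> E)"
  shows "3 \<le> card {e \<in> E. \<gamma> e (1/2) \<in> closure f}"
proof (rule ccontr)
  define I where "I = {e \<in> E. \<gamma> e (1/2) \<in> closure f}"
  assume "\<not> 3 \<le> card {e \<in> E. \<gamma> e (1/2) \<in> closure f}"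
  then have cI: "card I \<le> 2" by (simp add: I_def)
  have IE: "I \<subseteq> E" and finI: "finite I" using finite_edges by (auto simp: I_def)
  have "\<exists>d > 0. d < 1/2 \<and> \<gamma> e ` {1/2 - d<..<1/2 + d} \<inter> closure f = {}" if e: "e \<in> E - I" for e
  proof -
    have "continuous_on {0..1} (\<gamma> e)" using arc_edge e by (auto simp: arc_def path_def)
    then have "continuous_on {0<..<1} (\<gamma> e)" by (rule continuous_on_subset) auto
    then have "open ({0<..<1} \<inter> \<gamma> e -` (- closure f))"
      by (intro continuous_open_preimage) auto
    moreover have "1/2 \<in> {0<..<1} \<inter> \<gamma> e -` (- closure f)" using e by (auto simp: I_def)
    ultimately obtain r where r: "r > 0" "ball (1/2) r \<subseteq> {0<..<1} \<inter> \<gamma> e -` (- closure f)"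
      by (meson open_contains_ball)
    \<comment> \<open>The bound 1/4 keeps the window strictly inside the parameter interval, so that
      a stub remains at either end.\<close>
    let ?d = "min r (1/4)"
    have "{1/2 - ?d<..<1/2 + ?d} \<subseteq> ball (1/2) r" by (auto simp: dist_real_def)
    then have "\<gamma> e ` {1/2 - ?d<..<1/2 + ?d} \<inter> closure f = {}" using r by blast
    then show ?thesis using r(1) by (intro exI [of _ ?d]) auto
  qed
  then obtain \<delta> where \<delta>: "\<And>e. e \<in> E - I \<Longrightarrow> 0 < \<delta> e" "\<And>e. e \<in> E - I \<Longrightarrow> \<delta> e < 1/2"
    "\<And>e. e \<in> E - I \<Longrightarrow> \<gamma> e ` {1/2 - \<delta> e<..<1/2 + \<delta> e} \<inter> closure f = {}"
    by metis
  let ?A = "\<Union>e\<in>I. path_image (\<gamma> e)" and ?B = "\<Union>v\<in>V. {pos v}"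
  \<comment> \<open>Removing the window from an edge that is not seen from \<open>f\<close> leaves
    two stubs; the flag \<open>True\<close> selects the one at parameter 0.\<close>
  define P where "P j = \<gamma> (fst j) ` (if snd j then {0..1/2 - \<delta> (fst j)} else {1/2 + \<delta> (fst j)..1})" for j
  define J where "J = (E - I) \<times> (UNIV :: bool set)"
  \<comment> \<open>The forest is built in three stages: the edges in \<open>I\<close>, the
    vertices, the stubs. With at most two edges in \<open>I\<close>, each meets the rest of
    \<open>I\<close> in at most one point; three edges could already form a triangle.\<close>
  have conA: "connected (- ({} \<union> ?A))"
  proof (rule connected_complement_UN [OF finI])
    show "compact (path_image (\<gamma> e)) \<and> connected (- path_image (\<gamma> e))" if "e \<in> I" for e
      using arc_edge IE that by (auto intro: compact_arc_image connected_planar_arc_complement)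
    show "\<exists>q. path_image (\<gamma> e) \<inter> {} \<subseteq> {q} \<and> (\<forall>i\<in>I - {e}. path_image (\<gamma> e) \<inter> path_image (\<gamma> i) \<subseteq> {q})"
      if e: "e \<in> I" for e
    proof (cases "I = {e}")
      case False
      then obtain g where g: "g \<in> I" "g \<noteq> e" using e by auto
      have "I = {e, g}"
      proof (rule card_subset_eq [symmetric, OF finI])
        show "{e, g} \<subseteq> I" using e g by auto
        then have "card {e, g} \<le> card I" using finI by (intro card_mono)
        then show "card {e, g} = card I" using cI g by simp
      qed
      moreover obtain q where "path_image (\<gamma> e) \<inter> path_image (\<gamma> g) \<subseteq> {q}"
        using two_edges_meet [of e g] e g IE by blast
      ultimately show ?thesis using g by auto
    qed auto
  qed auto
  have comA: "compact ?A" using finI arc_edge IE by (intro compact_UN) (auto intro: compact_arc_image)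
  have conB: "connected (- (?A \<union> ?B))"
  proof (rule connected_complement_UN [OF finite_vertices comA])
    show "connected (- ?A)" using conA by simp
    show "\<exists>q. {pos v} \<inter> ?A \<subseteq> {q} \<and> (\<forall>i\<in>V - {v}. {pos v} \<inter> {pos i} \<subseteq> {q})" for v by blast
    show "compact {pos v} \<and> connected (- {pos v})" for v
      by (simp add: connected_punctured_universe)
  qed
  have comB: "compact (?A \<union> ?B)"
    by (rule compact_Un [OF comA finite_imp_compact]) (simp add: finite_vertices)
  define K where "K = ?A \<union> ?B \<union> (\<Union>j\<in>J. P j)"
  have comP: "compact (P j) \<and> connected (- P j)" if j: "j \<in> J" for j
  proof -
    obtain e b where eb: "j = (e, b)" "e \<in> E - I" using j by (auto simp: J_def)
    have "P j = path_image (if b then subpath 0 (1/2 - \<delta> e) (\<gamma> e) else subpath (1/2 + \<delta> e) 1 (\<gamma> e))"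
      using \<delta>(1,2) [OF eb(2)] by (simp add: P_def eb(1) path_image_subpath)
    moreover have "arc (if b then subpath 0 (1/2 - \<delta> e) (\<gamma> e) else subpath (1/2 + \<delta> e) 1 (\<gamma> e))"
      using \<delta>(1,2) [OF eb(2)] arc_edge eb(2) by (auto intro!: arc_subpath_arc)
    ultimately show ?thesis by (metis compact_arc_image connected_planar_arc_complement)
  qed
  \<comment> \<open>A stub is attached at its vertex only. The two stubs of one edge do not touch,
    since the window between them has positive width.\<close>
  have stub: "z = \<gamma> e (if b then 0 else 1)"
    if e: "e \<in> E - I" and z: "z \<in> P (e, b)"
      and z': "z \<in> ?A \<or> z \<in> ?B \<or> (\<exists>i \<in> J - {(e, b)}. z \<in> P i)" for e b z
  proof (rule ccontr)
    assume ne: "z \<noteq> \<gamma> e (if b then 0 else 1)"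
    obtain t where t: "z = \<gamma> e t" "t \<in> (if b then {0..1/2 - \<delta> e} else {1/2 + \<delta> e..1})"
      using z by (auto simp: P_def split: if_splits)
    have t01: "0 < t" "t < 1" using t ne \<delta>(1,2) [OF e] by (auto simp: order_less_le split: if_splits)
    have "e \<in> E" using e by auto
    note int = edge_interior_point [OF this t01]
    have sub: "P (g, c) \<subseteq> path_image (\<gamma> g)" if "g \<in> E - I" for g c
      using \<delta>(1,2) [OF that] by (auto simp: P_def path_image_def)
    have "z \<notin> ?B" using int(1) t by auto
    moreover have "z \<notin> ?A" using int(2) t e IE by blast
    ultimately obtain g c where gc: "(g, c) \<in> J" "(g, c) \<noteq> (e, b)" "z \<in> P (g, c)" using z' by auto
    have g: "g \<in> E - I" using gc(1) by (auto simp: J_def)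
    have "g = e" using int(2) [of g] sub [OF g] gc(3) t(1) g by blast
    with gc have "c = (\<not> b)" "z \<in> P (e, \<not> b)" by auto
    then obtain s where s: "z = \<gamma> e s" "s \<in> (if b then {1/2 + \<delta> e..1} else {0..1/2 - \<delta> e})"
      by (auto simp: P_def split: if_splits)
    have "s = t" using edge_inj [OF \<open>e \<in> E\<close>, of s t] s t t01 \<delta>(1,2) [OF e] by (auto split: if_splits)
    then show False using s(2) t(2) \<delta>(1) [OF e] by (auto split: if_splits)
  qed
  have conK: "connected (- K)"
    unfolding K_def
  proof (rule connected_complement_UN [OF _ comB conB comP])
    show "finite J" using finite_edges by (simp add: J_def)
    fix j assume "j \<in> J"
    then obtain e b where eb: "j = (e, b)" "e \<in> E - I" by (auto simp: J_def)
    show "\<exists>q. P j \<inter> (?A \<union> ?B) \<subseteq> {q} \<and> (\<forall>i \<in> J - {j}. P j \<inter> P i \<subseteq> {q})"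
      unfolding eb(1) using stub [OF eb(2), of _ b]
      by (intro exI [of _ "\<gamma> e (if b then 0 else 1)"]) blast
  qed
  have fdr: "f \<subseteq> - drawn V pos \<gamma> E" using f by (rule in_components_subset)
  have "frontier f \<subseteq> K"
  proof
    fix z assume z: "z \<in> frontier f"
    have "z \<in> drawn V pos \<gamma> E"
      using frontier_of_components_closed_complement [OF closed_drawn f] z by auto
    then consider "z \<in> ?B" | e where "e \<in> E" "z \<in> path_image (\<gamma> e)" by (auto simp: drawn_def)
    then show "z \<in> K"
    proof cases
      case 2
      then obtain t where t: "z = \<gamma> e t" "0 \<le> t" "t \<le> 1" by (auto simp: path_image_def)
      show ?thesis
      proof (cases "e \<in> I")
        case True
        then show ?thesis using 2 by (auto simp: K_def)
      next
        case False
        then have e: "e \<in> E - I" using 2 by auto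
        have "z \<in> closure f" using z by (simp add: frontier_def)
        then have "t \<notin> {1/2 - \<delta> e<..<1/2 + \<delta> e}" using \<delta>(3) [OF e] t(1) by blast
        then have "z \<in> P (e, True) \<or> z \<in> P (e, False)" using t by (auto simp: P_def)
        moreover have "(e, True) \<in> J" "(e, False) \<in> J" using e by (auto simp: J_def)
        ultimately show ?thesis unfolding K_def by blast
      qed
    qed (simp add: K_def)
  qed
  \<comment> \<open>There are at least three edges, so some edge is not seen from \<open>f\<close>.
    Its midpoint lies outside both \<open>K\<close> and \<open>f\<close>, so the connected
    complement of \<open>K\<close> would have to cross the frontier of \<open>f\<close>, which lies
    in \<open>K\<close>.\<close>
  have "\<not> E \<subseteq> I"
  proof
    assume "E \<subseteq> I"
    then have "card E \<le> card I" using finI by (rule card_mono [rotated])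
    then show False using assms(1) cI by simp
  qed
  then obtain e where e: "e \<in> E - I" by auto
  let ?m = "\<gamma> e (1/2)"
  have mK: "?m \<notin> K"
  proof
    assume "?m \<in> K"
    moreover have "?m \<notin> ?A" "?m \<notin> ?B" using edge_interior_point [of e "1/2"] e IE by auto
    ultimately obtain g c where gc: "(g, c) \<in> J" "?m \<in> P (g, c)" unfolding K_def by auto
    have g: "g \<in> E - I" using gc(1) by (auto simp: J_def)
    obtain t where t: "?m = \<gamma> g t" "t \<in> (if c then {0..1/2 - \<delta> g} else {1/2 + \<delta> g..1})"
      using gc(2) by (auto simp: P_def split: if_splits)
    have t01: "t \<in> {0..1}" using t(2) \<delta>(1,2) [OF g] by (auto split: if_splits)
    then have "g = e" using edge_interior_point(2) [of e "1/2" g] e g t(1) by (auto simp: path_image_def)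
    then have "t = 1/2" using edge_inj [of e "1/2" t] e t(1) t01 by auto
    then show False using t(2) \<delta>(1) [OF g] by (auto split: if_splits)
  qed
  have "?m \<in> path_image (\<gamma> e)" by (simp add: path_image_def)
  then have "?m \<in> drawn V pos \<gamma> E" using e by (auto simp: drawn_def)
  then have "?m \<notin> f" using fdr by auto
  have "K \<subseteq> drawn V pos \<gamma> E"
  proof -
    have "P j \<subseteq> drawn V pos \<gamma> E" if j: "j \<in> J" for j
    proof -
      obtain g c where "j = (g, c)" "g \<in> E - I" using j by (auto simp: J_def)
      then show ?thesis using \<delta>(1,2) [of g] by (force simp: P_def drawn_def path_image_def split: if_splits)
    qed
    then show ?thesis using IE by (auto simp: K_def drawn_def)
  qed
  then have "f \<subseteq> - K" using fdr by auto
  moreover have "f \<noteq> {}" using f by (rule in_components_nonempty)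
  ultimately have "- K \<inter> f \<noteq> {}" by auto
  moreover have "- K - f \<noteq> {}" using mK \<open>?m \<notin> f\<close> by auto
  ultimately have "- K \<inter> frontier f \<noteq> {}" using connected_Int_frontier [OF conK] by blast
  then show False using \<open>frontier f \<subseteq> K\<close> by auto
qed

section \<open>The edge bound for planar graphs\<close>

text \<open>Double counting of pairs of a face and an edge whose midpoint lies in its closure gives
  \<open>3 * card \<F> \<le> 2 * card E\<close>. With Euler's inequality this yields even
  \<open>card E + 6 \<le> 3 * card V\<close> when there are three edges; the constant 3 also admits
  the small cases, down to a single vertex.\<close>

lemma card_edges_bound:
  assumes "V \<noteq> {}"
  shows "card E + 3 \<le> 3 * card V"
proof (cases "3 \<le> card E")
  case True
  obtain \<F> where \<F>: "\<F> \<subseteq> components (- drawn V pos \<gamma> E)" "finite \<F>"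
    "card E + card ((\<lambda>v. connectivity E `` {v}) ` V) + 1 \<le> card V + card \<F>"
    using euler_faces [OF order_refl] by blast
  have "card ((\<lambda>v. connectivity E `` {v}) ` V) \<noteq> 0"
    using assms finite_vertices by simp
  then have euler: "card E + 2 \<le> card V + card \<F>" using \<F>(3) by linarith
  have sides: "card {f \<in> \<F>. \<gamma> e (1/2) \<in> closure f} \<le> 2" if e: "e \<in> E" for e
  proof -
    have dr: "drawn V pos \<gamma> E = drawn V pos \<gamma> (E - {e}) \<union> path_image (\<gamma> e)"
      using drawn_insert [of e "E - {e}"] e by (simp add: insert_absorb)
    have "finite {f \<in> \<F>. \<gamma> e (1/2) \<in> closure f} \<and> card {f \<in> \<F>. \<gamma> e (1/2) \<in> closure f} \<le> 2"
    proof (rule components_at_midpoint_le_two)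
      show "closed (drawn V pos \<gamma> (E - {e}))" by (rule closed_drawn) auto
      show "arc (\<gamma> e)" using arc_edge e .
      show "path_image (\<gamma> e) \<inter> drawn V pos \<gamma> (E - {e}) = {pathstart (\<gamma> e), pathfinish (\<gamma> e)}"
        using e by (intro edge_Int_drawn) auto
      show "f \<in> components (- (drawn V pos \<gamma> (E - {e}) \<union> path_image (\<gamma> e))) \<and> \<gamma> e (1/2) \<in> closure f"
        if "f \<in> {f \<in> \<F>. \<gamma> e (1/2) \<in> closure f}" for f
        using that \<F>(1) unfolding dr by blast
    qed
    then show ?thesis ..
  qed
  have "3 * card \<F> = (\<Sum>f\<in>\<F>. 3)" by simp
  also have "\<dots> \<le> (\<Sum>f\<in>\<F>. card {e \<in> E. \<gamma> e (1/2) \<in> closure f})"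
    using face_incident_edges [OF True] \<F>(1) by (intro sum_mono) auto
  also have "\<dots> = (\<Sum>e\<in>E. card {f \<in> \<F>. \<gamma> e (1/2) \<in> closure f})"
    by (rule sum_multicount_gen) (use \<F>(2) finite_edges in auto)
  also have "\<dots> \<le> (\<Sum>e\<in>E. 2)" using sides by (intro sum_mono) auto
  finally have "3 * card \<F> \<le> 2 * card E" by simp
  then show ?thesis using euler by linarith
next
  case False
  show ?thesis
  proof (cases "E = {}")
    case True
    then show ?thesis using assms finite_vertices by (simp add: Suc_le_eq card_gt_0_iff)
  next
    case nE: False
    then obtain e where "e \<in> E" by auto
    then have "2 \<le> card V" using edgeD [of e] card_mono [OF finite_vertices, of e] by simp
    then show ?thesis using False by simp
  qed
qed

end

lemma planar_card_edges_bound: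
  assumes "planar_graph V E" "V \<noteq> {}"
  shows "card E + 3 \<le> 3 * card V"
proof -
  obtain pos \<gamma> where "plane_graph V E pos \<gamma>"
    using assms(1) by (auto simp: planar_graph_def plane_graph_def)
  then show ?thesis using plane_graph.card_edges_bound assms(2) by blast
qed

lemma planar_subgraph:
  assumes "planar_graph V E" "V' \<subseteq> V" "F \<subseteq> E" "\<And>e. e \<in> F \<Longrightarrow> e \<subseteq> V'"
  shows "planar_graph V' F"
proof -
  obtain pos \<gamma> where s: "simple_graph V E" and d: "plane_drawing V E pos \<gamma>"
    using assms(1) by (auto simp: planar_graph_def)
  have "simple_graph V' F"
    using s assms(2-4) finite_subset by (auto simp: simple_graph_def)
  moreover have "plane_drawing V' F pos \<gamma>"
    unfolding plane_drawing_def
  proof (intro conjI ballI impI)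
    show "inj_on pos V'" using d assms(2) by (auto simp: plane_drawing_def intro: inj_on_subset)
    fix e assume e: "e \<in> F"
    then have eE: "e \<in> E" using assms(3) by auto
    show "arc (\<gamma> e)" "{pathstart (\<gamma> e), pathfinish (\<gamma> e)} = pos ` e"
      using d eE by (simp_all add: plane_drawing_def)
    have "(path_image (\<gamma> e) - pos ` e) \<inter> pos ` V = {}" using d eE by (simp add: plane_drawing_def)
    then show "(path_image (\<gamma> e) - pos ` e) \<inter> pos ` V' = {}" using assms(2) by blast
    fix f assume "f \<in> F" "e \<noteq> f"
    moreover have "f \<in> E" using \<open>f \<in> F\<close> assms(3) by auto
    ultimately show "(path_image (\<gamma> e) - pos ` e) \<inter> path_image (\<gamma> f) = {}"
      using d eE by (simp add: plane_drawing_def)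
  qed
  ultimately show ?thesis by (auto simp: planar_graph_def)
qed

section \<open>Matchings\<close>

lemma matching_eqI: "matching E M \<Longrightarrow> e \<in> M \<Longrightarrow> f \<in> M \<Longrightarrow> v \<in> e \<Longrightarrow> v \<in> f \<Longrightarrow> e = f"
  unfolding matching_def by (metis disjoint_iff)

lemma matching_subset: "matching E M \<Longrightarrow> N \<subseteq> M \<Longrightarrow> matching E N"
  unfolding matching_def by (metis subset_iff)

lemma matching_insert:
  assumes "matching E M" "e \<in> E" "e \<inter> \<Union>M = {}" shows "matching E (insert e M)"
proof -
  have "e \<inter> f = {} \<and> f \<inter> e = {}" if "f \<in> M" for f using assms(3) that by blast
  then show ?thesis using assms(1,2) by (auto simp: matching_def)
qed

lemma matching_Union_Diff:
  assumes "matching E M" "e \<in> M" shows "\<Union>(M - {e}) = \<Union>M - e"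
proof -
  have "f \<inter> e = {}" if "f \<in> M - {e}" for f
    using assms that by (auto simp: matching_def)
  then show ?thesis using assms(2) by blast
qed

section \<open>Exchanges between two matchings\<close>

text \<open>No vertex set is recorded: the covered vertices of a matching are its union, and edge
  sets left after deleting vertices satisfy the locale again.\<close>

locale edges =
  fixes E :: "'a set set"
  assumes finE: "finite E" and card2: "e \<in> E \<Longrightarrow> card e = 2"
begin

lemma matching_finite: "matching E M \<Longrightarrow> finite M"
  using finite_subset [OF _ finE] by (simp add: matching_def)

lemma edge_finite: "e \<in> E \<Longrightarrow> finite e"
  using card2 [of e] card.infinite [of e] by (cases "finite e") auto

lemma edge_obtain:
  assumes "e \<in> E" "v \<in> e" obtains w where "e = {v, w}" "v \<noteq> w"
proof -
  obtain a b where "e = {a, b}" "a \<noteq> b" using card2 [OF assms(1)] unfolding card_2_iff by blast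
  then show ?thesis using that [of a] that [of b] assms(2) by blast
qed

lemma card_Union_matching: "matching E M \<Longrightarrow> card (\<Union>M) = 2 * card M"
proof -
  assume M: "matching E M"
  have "card (\<Union>M) = (\<Sum>e\<in>M. card e)"
    using M by (intro card_Union_disjoint) (auto simp: matching_def pairwise_def disjnt_def intro: edge_finite)
  also have "\<dots> = (\<Sum>e\<in>M. 2)" using M card2 by (intro sum.cong) (auto simp: matching_def)
  finally show ?thesis by simp
qed

lemma finite_Union_matching: "matching E M \<Longrightarrow> finite (\<Union>M)"
  by (rule finite_Union) (use matching_finite edge_finite in \<open>auto simp: matching_def\<close>)

lemma matching_remove:
  assumes "matching E M" "e \<in> M"
  obtains L where "matching E L" "\<Union>L = \<Union>M - e" "Suc (card L) = card M"
proof (rule that)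
  show "matching E (M - {e})" using assms by (auto intro: matching_subset)
  show "\<Union>(M - {e}) = \<Union>M - e" using assms by (rule matching_Union_Diff)
  show "Suc (card (M - {e})) = card M" using assms matching_finite by (intro card_Suc_Diff1)
qed

lemma matching_add:
  assumes "matching E M" "{v, w} \<in> E" "v \<notin> \<Union>M" "w \<notin> \<Union>M"
  obtains L where "matching E L" "\<Union>L = \<Union>M \<union> {v, w}" "card L = Suc (card M)"
proof (rule that)
  show "matching E (insert {v, w} M)" using assms by (intro matching_insert) auto
  show "\<Union>(insert {v, w} M) = \<Union>M \<union> {v, w}" by auto
  have "{v, w} \<notin> M" using assms(3) by blast
  then show "card (insert {v, w} M) = Suc (card M)" using assms(1) by (simp add: matching_finite)
qed

text \<open>Follow the path from \<open>v\<close> that alternates between \<open>M\<close> and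
  \<open>N\<close>. If it ends at a vertex covered by \<open>N\<close> only, flipping
  \<open>M\<close> along it trades \<open>v\<close> for that vertex. If it ends at a vertex covered
  by \<open>M\<close> only, flipping both matchings moves one edge's worth of size from
  \<open>M\<close> to \<open>N\<close>. The path stays implicit: the induction strips its first two
  edges and tracks only sizes and covered vertices.\<close>

lemma toggle:
  assumes "matching E M" "matching E N" "v \<in> \<Union>M" "v \<notin> \<Union>N"
  shows "(\<exists>z M'. z \<in> \<Union>N - \<Union>M \<and> matching E M' \<and> card M' = card M \<and> \<Union>M' = insert z (\<Union>M - {v})) \<or>
         (\<exists>z M' N'. z \<in> \<Union>M - \<Union>N \<and> z \<noteq> v \<and> matching E M' \<and> matching E N' \<and>
            Suc (card M') = card M \<and> \<Union>M' = \<Union>M - {v, z} \<and> card N' = Suc (card N) \<and> \<Union>N' = insert v (insert z (\<Union>N)))"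
    (is "?even M N v \<or> ?odd M N v")
  using assms
proof (induction "card N" arbitrary: M N v rule: less_induct)
  case less
  note M = less.prems(1) and N = less.prems(2) and vN = less.prems(4)
  obtain e where e: "e \<in> M" "v \<in> e" using less.prems by auto
  have eE: "e \<in> E" using e M by (auto simp: matching_def)
  obtain w where w: "e = {v, w}" "v \<noteq> w" using edge_obtain [OF eE e(2)] .
  have vwE: "{v, w} \<in> E" using eE w by simp
  have vwM: "v \<in> \<Union>M" "w \<in> \<Union>M" using e w by auto
  obtain M1 where M1: "matching E M1" "\<Union>M1 = \<Union>M - {v, w}" "Suc (card M1) = card M"
    using matching_remove [OF M e(1)] w by metis
  show ?case
  proof (cases "w \<in> \<Union>N")
    case False
    obtain N1 where N1: "matching E N1" "\<Union>N1 = \<Union>N \<union> {v, w}" "card N1 = Suc (card N)"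
      using matching_add [OF N vwE vN False] .
    have "\<Union>N1 = insert v (insert w (\<Union>N))" using N1(2) by auto
    then have "?odd M N v"
      using M1 N1 w False vwM by (intro exI [of _ w] exI [of _ M1] exI [of _ N1] conjI) simp_all
    then show ?thesis ..
  next
    case True
    then obtain f where f: "f \<in> N" "w \<in> f" by auto
    have fE: "f \<in> E" using f N by (auto simp: matching_def)
    obtain z where z: "f = {w, z}" "w \<noteq> z" using edge_obtain [OF fE f(2)] .
    have wzE: "{w, z} \<in> E" using fE z by simp
    have zN: "z \<in> \<Union>N" using f z by auto
    then have zv: "z \<noteq> v" using vN by auto
    obtain N1 where N1: "matching E N1" "\<Union>N1 = \<Union>N - {w, z}" "Suc (card N1) = card N"
      using matching_remove [OF N f(1)] z by metis
    show ?thesis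
    proof (cases "z \<in> \<Union>M")
      case False
      obtain M2 where M2: "matching E M2" "\<Union>M2 = \<Union>M1 \<union> {w, z}" "card M2 = Suc (card M1)"
        by (rule matching_add [OF M1(1) wzE]) (use M1(2) False in auto)
      have "\<Union>M2 = insert z (\<Union>M - {v})"
        unfolding M2 M1 using vwM zN True z(2) w(2) zv by blast
      then have "?even M N v"
        using M1 M2 zN False by (intro exI [of _ z] exI [of _ M2] conjI) simp_all
      then show ?thesis ..
    next
      case zM: True
      have lt: "card N1 < card N" using N1 by simp
      have zM1: "z \<in> \<Union>M1" using zM zv z M1 by auto
      have zN1: "z \<notin> \<Union>N1" using N1 by auto
      \<comment> \<open>Without the edges \<open>{v, w}\<close> of \<open>M\<close> and
        \<open>{w, z}\<close> of \<open>N\<close>, the situation repeats at \<open>z\<close>.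
        Flipping the stripped edges means adding \<open>{w, z}\<close> to the first matching and, in
        the odd case, \<open>{v, w}\<close> to the second.\<close>
      from less.hyps [OF lt M1(1) N1(1) zM1 zN1] show ?thesis
      proof
        assume "?even M1 N1 z"
        then obtain y M' where y: "y \<in> \<Union>N1 - \<Union>M1"
          and M': "matching E M'" "card M' = card M1" "\<Union>M' = insert y (\<Union>M1 - {z})" by blast
        have ny: "y \<noteq> v" "y \<noteq> w" "y \<noteq> z" "y \<in> \<Union>N - \<Union>M" using y N1(2) M1(2) vN zM1 by auto
        obtain M2 where M2: "matching E M2" "\<Union>M2 = \<Union>M' \<union> {w, z}" "card M2 = Suc (card M')"
          by (rule matching_add [OF M'(1) wzE]) (use M'(3) M1(2) ny in auto)
        have "\<Union>M2 = insert y (\<Union>M - {v})"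
          unfolding M2 M' M1 using vwM zN zM True z(2) w(2) zv ny by blast
        then have "?even M N v"
          using M1 M' M2 ny by (intro exI [of _ y] exI [of _ M2] conjI) simp_all
        then show ?thesis ..
      next
        assume "?odd M1 N1 z"
        then obtain y M' N' where y: "y \<in> \<Union>M1 - \<Union>N1" "y \<noteq> z"
          and M': "matching E M'" "Suc (card M') = card M1" "\<Union>M' = \<Union>M1 - {z, y}"
          and N': "matching E N'" "card N' = Suc (card N1)" "\<Union>N' = insert z (insert y (\<Union>N1))" by blast
        have ny: "y \<noteq> v" "y \<noteq> w" "y \<in> \<Union>M - \<Union>N" using y N1(2) M1(2) by auto
        obtain M2 where M2: "matching E M2" "\<Union>M2 = \<Union>M' \<union> {w, z}" "card M2 = Suc (card M')"
          by (rule matching_add [OF M'(1) wzE]) (use M'(3) M1(2) in auto)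
        obtain N2 where N2: "matching E N2" "\<Union>N2 = \<Union>N' \<union> {v, w}" "card N2 = Suc (card N')"
          by (rule matching_add [OF N'(1) vwE]) (use N'(3) N1(2) vN ny z zv in auto)
        have "\<Union>M2 = \<Union>M - {v, y}" "\<Union>N2 = insert v (insert y (\<Union>N))"
          unfolding M2 N2 M' N' M1 N1 using vwM zN zM True z(2) w(2) zv ny y(2) by blast+
        then have "?odd M N v"
          using M1 N1 M' N' M2 N2 ny by (intro exI [of _ y] exI [of _ M2] exI [of _ N2] conjI) simp_all
        then show ?thesis ..
      qed
    qed
  qed
qed

end

lemma maximum_matching_card_le:
  "maximum_matching E M \<Longrightarrow> matching E N \<Longrightarrow> card N \<le> card M"
  by (simp add: maximum_matching_def)

lemma path_edges_simps [simp]: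
  "path_edges [] = []" "path_edges [v] = []" "path_edges (v # w # p) = {v, w} # path_edges (w # p)"
  by (simp_all add: path_edges_def)

context edges
begin

text \<open>The recursion of \<open>toggle\<close> again, now recording the vertex list, because
  switchability asks for an actual path. Edges at even positions come from \<open>K\<close>, so the
  parity of the length decides which matching alone covers the last vertex.\<close>

lemma alternating_walk:
  assumes "matching E K" "matching E L" "v \<in> \<Union>K" "v \<notin> \<Union>L"
  shows "\<exists>p. p \<noteq> [] \<and> hd p = v \<and> distinct p \<and> set p \<subseteq> \<Union>K \<union> \<Union>L \<and> path_edges p \<noteq> [] \<and>
    (\<forall>i < length (path_edges p). path_edges p ! i \<in> (if even i then K - L else L - K)) \<and>
    last p \<in> (if even (length (path_edges p)) then \<Union>L - \<Union>K else \<Union>K - \<Union>L - {v})"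
  using assms
proof (induction "card L" arbitrary: K L v rule: less_induct)
  case less
  note K = less.prems(1) and L = less.prems(2) and vL = less.prems(4)
  obtain e where e: "e \<in> K" "v \<in> e" using less.prems by auto
  have eE: "e \<in> E" using e K by (auto simp: matching_def)
  obtain w where w: "e = {v, w}" "v \<noteq> w" using edge_obtain [OF eE e(2)] .
  have eL: "e \<notin> L" using vL e(2) by auto
  have vwK: "v \<in> \<Union>K" "w \<in> \<Union>K" using e w by auto
  show ?case
  proof (cases "w \<in> \<Union>L")
    case False
    then show ?thesis using e w eL vwK by (intro exI [of _ "[v, w]"]) auto
  next
    case True
    then obtain f where f: "f \<in> L" "w \<in> f" by auto
    have fE: "f \<in> E" using f L by (auto simp: matching_def)
    obtain z where z: "f = {w, z}" "w \<noteq> z" using edge_obtain [OF fE f(2)] .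
    have fK: "f \<notin> K" using matching_eqI [OF K e(1), of f w] e(2) f w vL by auto
    have zL: "z \<in> \<Union>L" using f z by auto
    then have zv: "z \<noteq> v" using vL by auto
    show ?thesis
    proof (cases "z \<in> \<Union>K")
      case False
      have "{v, w} \<in> K - L" "{w, z} \<in> L - K" using e f eL fK w z by auto
      then show ?thesis using zL zv z(2) w(2) False True vwK
        by (intro exI [of _ "[v, w, z]"]) (auto simp: less_Suc_eq)
    next
      case zK: True
      let ?K = "K - {e}" and ?L = "L - {f}"
      have UK: "\<Union>?K = \<Union>K - {v, w}" and UL: "\<Union>?L = \<Union>L - {w, z}"
        using matching_Union_Diff [OF K e(1)] matching_Union_Diff [OF L f(1)] w z by auto
      have "card ?L < card L" using f L by (intro card_Diff1_less) (auto intro: matching_finite)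
      moreover have "matching E ?K" "matching E ?L" using K L by (auto intro: matching_subset)
      moreover have "z \<in> \<Union>?K" "z \<notin> \<Union>?L" unfolding UK UL using zK zv z(2) by auto
      ultimately have "\<exists>p. p \<noteq> [] \<and> hd p = z \<and> distinct p \<and> set p \<subseteq> \<Union>?K \<union> \<Union>?L \<and> path_edges p \<noteq> [] \<and>
        (\<forall>i < length (path_edges p). path_edges p ! i \<in> (if even i then ?K - ?L else ?L - ?K)) \<and>
        last p \<in> (if even (length (path_edges p)) then \<Union>?L - \<Union>?K else \<Union>?K - \<Union>?L - {z})"
        by (rule less.hyps)
      then obtain p where p: "p \<noteq> []" "hd p = z" "distinct p" "set p \<subseteq> \<Union>?K \<union> \<Union>?L" "path_edges p \<noteq> []"
        and alt: "\<And>i. i < length (path_edges p) \<Longrightarrow> path_edges p ! i \<in> (if even i then ?K - ?L else ?L - ?K)"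
        and lst: "last p \<in> (if even (length (path_edges p)) then \<Union>?L - \<Union>?K else \<Union>?K - \<Union>?L - {z})"
        by blast
      obtain q where q: "p = z # q" using p(1,2) by (cases p) auto
      have pe: "path_edges (v # w # p) = e # f # path_edges p" by (simp add: q w z)
      have len: "length (path_edges (v # w # p)) = Suc (Suc (length (path_edges p)))"
        by (simp only: pe length_Cons)
      have vw: "v \<notin> set p" "w \<notin> set p" using p(4) vL unfolding UK UL by auto
      have sub: "?K - ?L \<subseteq> K - L" "?L - ?K \<subseteq> L - K" using eL fK by auto
      have alt': "path_edges (v # w # p) ! i \<in> (if even i then K - L else L - K)"
        if "i < length (path_edges (v # w # p))" for i
      proof -
        \<comment> \<open>Two edges are prepended, so the indices of the remaining path shift by two
          and keep their parity.\<close>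
        consider "i = 0" | "i = 1" | j where "i = Suc (Suc j)" by (metis One_nat_def not0_implies_Suc)
        then show ?thesis
        proof cases
          case 3
          then have "path_edges p ! j \<in> (if even i then ?K - ?L else ?L - ?K)"
            using alt [of j] that unfolding len by simp
          then show ?thesis using 3 sub unfolding pe by (auto split: if_splits)
        qed (use e f eL fK in \<open>auto simp only: pe nth_Cons_0 nth_Cons_Suc One_nat_def, auto\<close>)
      qed
      have lp: "last p \<noteq> v" "last p \<noteq> w" using vw last_in_set [OF p(1)] by auto
      have "last p \<in> (if even (length (path_edges p)) then \<Union>L - \<Union>K else \<Union>K - \<Union>L - {v})"
        using lst lp unfolding UK UL by (auto split: if_splits)
      then have "last (v # w # p) \<in> (if even (length (path_edges (v # w # p))) then \<Union>L - \<Union>K else \<Union>K - \<Union>L - {v})"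
        unfolding pe using p(1) by simp
      moreover have "set (v # w # p) \<subseteq> \<Union>K \<union> \<Union>L"
      proof -
        have "set p \<subseteq> \<Union>K \<union> \<Union>L" using p(4) unfolding UK UL by blast
        then show ?thesis using vwK by simp
      qed
      moreover have "distinct (v # w # p)" using p(3) vw w(2) by simp
      moreover have "path_edges (v # w # p) \<noteq> []" by (simp add: pe)
      ultimately show ?thesis using alt'
        by (intro exI [of _ "v # w # p"] conjI allI impI) (simp_all del: path_edges_simps)
    qed
  qed
qed

lemma maximum_matching_exists: "\<exists>M. maximum_matching E M"
proof -
  have "matching E {}" by (simp add: matching_def)
  moreover have "\<forall>M. matching E M \<longrightarrow> card M < Suc (card E)"
    using finE by (auto simp: matching_def less_Suc_eq_le intro: card_mono)
  ultimately show ?thesis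
    using ex_has_greatest_nat [of "matching E" "{}" card] unfolding maximum_matching_def by blast
qed

lemma maximum_matching_no_free_edge:
  assumes "maximum_matching E N" "{u, v} \<in> E" "u \<notin> \<Union>N" "v \<notin> \<Union>N" shows False
proof -
  have N: "matching E N" using assms(1) by (simp add: maximum_matching_def)
  obtain L where L: "matching E L" "\<Union>L = \<Union>N \<union> {u, v}" "card L = Suc (card N)"
    using matching_add [OF N assms(2-4)] .
  then show False using maximum_matching_card_le [OF assms(1) L(1)] by simp
qed

end

section \<open>Missable vertices and the Gallai-Edmonds argument\<close>

text \<open>These are the inessential vertices of Gallai-Edmonds theory. For finite \<open>E\<close>
  a vertex on no edge counts as missable, so the set \<open>D\<close> is later cut down to
  \<open>W\<close>.\<close>

definition missable :: "'a set set \<Rightarrow> 'a \<Rightarrow> bool" where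
  "missable E v \<longleftrightarrow> (\<exists>N. maximum_matching E N \<and> v \<notin> \<Union>N)"

text \<open>Only edges are removed; the deleted vertices stay behind as isolated ones and become
  missable. Comparisons of missability therefore exclude them.\<close>

definition delete_vertices :: "'a set set \<Rightarrow> 'a set \<Rightarrow> 'a set set" where
  "delete_vertices E A = {e \<in> E. e \<inter> A = {}}"

lemma matching_delete_vertices:
  "matching (delete_vertices E A) K \<longleftrightarrow> matching E K \<and> \<Union>K \<inter> A = {}"
proof -
  have "K \<subseteq> delete_vertices E A \<longleftrightarrow> K \<subseteq> E \<and> \<Union>K \<inter> A = {}"
    unfolding delete_vertices_def by blast
  then show ?thesis by (auto simp only: matching_def)
qed

lemma maximum_matching_card_eq:
  "maximum_matching E M \<Longrightarrow> maximum_matching E N \<Longrightarrow> card M = card N"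
  by (simp add: maximum_matching_def le_antisym)

lemma maximum_matchingI:
  "maximum_matching E M \<Longrightarrow> matching E N \<Longrightarrow> card M \<le> card N \<Longrightarrow> maximum_matching E N"
  unfolding maximum_matching_def using le_trans by blast

context edges
begin

lemma edges_delete: "edges (delete_vertices E A)"
  using finE card2 by unfold_locales (auto simp: delete_vertices_def)

text \<open>Every maximum matching covers \<open>a\<close>, so one edge is lost. A matching avoiding
  \<open>a\<close> that loses none would be a maximum matching of \<open>E\<close> missing
  \<open>a\<close>.\<close>

lemma delete_unmissable_vertex:
  assumes a: "\<not> missable E a" and M: "maximum_matching E M"
  obtains K where "maximum_matching (delete_vertices E {a}) K" "\<Union>K \<subseteq> \<Union>M" "Suc (card K) = card M"
proof -
  have "a \<in> \<Union>M" using a M by (auto simp: missable_def)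
  then obtain e where e: "e \<in> M" "a \<in> e" by auto
  have mM: "matching E M" using M by (simp add: maximum_matching_def)
  obtain K where K: "matching E K" "\<Union>K = \<Union>M - e" "Suc (card K) = card M"
    using matching_remove [OF mM e(1)] .
  have "card N \<le> card K" if N: "matching (delete_vertices E {a}) N" for N
  proof (rule ccontr)
    assume "\<not> card N \<le> card K"
    then have "maximum_matching E N"
      using N K(3) by (intro maximum_matchingI [OF M]) (auto simp: matching_delete_vertices)
    then show False using a N by (auto simp: missable_def matching_delete_vertices)
  qed
  then have "maximum_matching (delete_vertices E {a}) K"
    using K e(2) by (auto simp: maximum_matching_def matching_delete_vertices)
  then show ?thesis using that K by auto
qed

text \<open>The stability lemma of Gallai--Edmonds theory.\<close>

lemma missable_delete_iff:
  assumes a: "\<not> missable E a" and ad: "{a, d} \<in> E" and d: "missable E d" and wa: "w \<noteq> a"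
  shows "missable (delete_vertices E {a}) w \<longleftrightarrow> missable E w"
proof
  assume "missable E w"
  then obtain M where M: "maximum_matching E M" "w \<notin> \<Union>M" by (auto simp: missable_def)
  obtain K where "maximum_matching (delete_vertices E {a}) K" "\<Union>K \<subseteq> \<Union>M"
    using delete_unmissable_vertex [OF a M(1)] by metis
  then show "missable (delete_vertices E {a}) w" using M(2) unfolding missable_def by blast
next
  assume "missable (delete_vertices E {a}) w"
  then obtain N where N: "maximum_matching (delete_vertices E {a}) N" "w \<notin> \<Union>N"
    by (auto simp: missable_def)
  have mN: "matching E N" "a \<notin> \<Union>N"
    using N(1) by (auto simp: maximum_matching_def matching_delete_vertices)
  obtain M where M: "maximum_matching E M" "d \<notin> \<Union>M" using d by (auto simp: missable_def)
  have mM: "matching E M" using M by (simp add: maximum_matching_def)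
  show "missable E w"
  proof (cases "w \<in> \<Union>M")
    case False
    then show ?thesis using M by (auto simp: missable_def)
  next
    case True
    from toggle [OF mM mN(1) True N(2)] show ?thesis
    proof (elim disjE exE conjE)
      fix z M'
      assume z: "z \<in> \<Union>N - \<Union>M" and M': "matching E M'" "card M' = card M" "\<Union>M' = insert z (\<Union>M - {w})"
      have "w \<notin> \<Union>M'" using M'(3) z True by auto
      moreover have "maximum_matching E M'" using maximum_matchingI [OF M(1) M'(1)] M'(2) by simp
      ultimately show ?thesis by (auto simp: missable_def)
    next
      fix z M' N'
      assume z: "z \<in> \<Union>M - \<Union>N" "z \<noteq> w" and M': "matching E M'" "Suc (card M') = card M" "\<Union>M' = \<Union>M - {w, z}"
        and N': "matching E N'" "card N' = Suc (card N)" "\<Union>N' = insert w (insert z (\<Union>N))"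
      \<comment> \<open>\<open>N'\<close> is larger than the maximum matching \<open>N\<close> of
        the graph without \<open>a\<close>, so it covers \<open>a\<close>; besides \<open>w\<close>,
        the only new vertex is \<open>z\<close>.\<close>
      have "z = a"
      proof (rule ccontr)
        assume "z \<noteq> a"
        then have "matching (delete_vertices E {a}) N'"
          using N' mN(2) wa by (auto simp: matching_delete_vertices)
        then show False using maximum_matching_card_le [OF N(1)] N'(2) by force
      qed
      have da: "d \<noteq> w" using True M(2) by auto
      \<comment> \<open>\<open>M'\<close> misses \<open>a\<close>, \<open>w\<close> and
        \<open>d\<close>; the edge \<open>{a, d}\<close> restores the maximum size and leaves
        \<open>w\<close> uncovered.\<close>
      obtain L where L: "matching E L" "\<Union>L = \<Union>M' \<union> {a, d}" "card L = Suc (card M')"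
        by (rule matching_add [OF M'(1) ad]) (use M'(3) M(2) \<open>z = a\<close> in auto)
      have "maximum_matching E L" using maximum_matchingI [OF M(1) L(1)] L(3) M'(2) by simp
      moreover have "w \<notin> \<Union>L" unfolding L M' using wa da by auto
      ultimately show ?thesis by (auto simp: missable_def)
    qed
  qed
qed

end

lemma delete_vertices_insert:
  "delete_vertices E (insert a A) = delete_vertices (delete_vertices E A) {a}"
  by (auto simp: delete_vertices_def)

text \<open>The vertices are deleted one by one. By the stability lemma each remaining vertex of
  \<open>A\<close> stays unmissable and keeps its missable neighbour, so every deletion lowers the
  matching number by exactly one.\<close>

lemma (in edges) missable_delete_set:
  assumes "finite A" and "\<And>a. a \<in> A \<Longrightarrow> \<not> missable E a \<and> (\<exists>d. {a, d} \<in> E \<and> missable E d)"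
  shows "(\<forall>K M. maximum_matching (delete_vertices E A) K \<longrightarrow> maximum_matching E M \<longrightarrow> card K + card A = card M) \<and>
    (\<forall>w. w \<notin> A \<longrightarrow> (missable (delete_vertices E A) w \<longleftrightarrow> missable E w))"
  using assms
proof (induction A)
  case empty
  have "delete_vertices E {} = E" by (auto simp: delete_vertices_def)
  then show ?case by (auto intro: maximum_matching_card_eq)
next
  case (insert a A)
  then have IH: "\<And>K M. maximum_matching (delete_vertices E A) K \<Longrightarrow> maximum_matching E M \<Longrightarrow> card K + card A = card M"
    "\<And>w. w \<notin> A \<Longrightarrow> missable (delete_vertices E A) w \<longleftrightarrow> missable E w" by auto
  interpret del: edges "delete_vertices E A" by (rule edges_delete)
  obtain d where d: "\<not> missable E a" "{a, d} \<in> E" "missable E d" using insert.prems by auto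
  have dA: "d \<notin> A" using d(3) insert.prems by auto
  have nma: "\<not> missable (delete_vertices E A) a" using IH(2) insert.hyps d by auto
  have ad: "{a, d} \<in> delete_vertices E A" using d(2) dA insert.hyps by (auto simp: delete_vertices_def)
  have md: "missable (delete_vertices E A) d" using IH(2) dA d by auto
  have c: "card K + card (insert a A) = card M"
    if K: "maximum_matching (delete_vertices E (insert a A)) K" and M: "maximum_matching E M" for K M
  proof -
    obtain N where N: "maximum_matching (delete_vertices E A) N" using del.maximum_matching_exists ..
    obtain L where "maximum_matching (delete_vertices (delete_vertices E A) {a}) L" "Suc (card L) = card N"
      using del.delete_unmissable_vertex [OF nma N] by metis
    then have "Suc (card K) = card N"
      using maximum_matching_card_eq [OF K [unfolded delete_vertices_insert [of E a A]]] by simp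
    then show ?thesis using IH(1) [OF N M] insert.hyps by simp
  qed
  have m: "missable (delete_vertices E (insert a A)) w \<longleftrightarrow> missable E w" if "w \<notin> insert a A" for w
    using del.missable_delete_iff [OF nma ad md, of w] IH(2) [of w] that
    by (simp add: delete_vertices_insert [of E a A])
  show ?case by (intro conjI allI impI; (rule c | rule m); assumption)
qed

text \<open>Gallai's lemma. If \<open>N\<close> misses both \<open>u\<close> and \<open>v\<close>,
  let \<open>t\<close> be the vertex before \<open>v\<close> and take a maximum matching
  \<open>K\<close> missing \<open>t\<close> with the largest overlap with \<open>N\<close>. By
  induction \<open>N\<close> covers \<open>t\<close> and \<open>K\<close> covers \<open>u\<close>;
  also \<open>K\<close> covers \<open>v\<close>. Comparing sizes, \<open>N\<close> covers some
  \<open>y\<close> other than \<open>t\<close> that \<open>K\<close> misses. Trading an edge of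
  \<open>K\<close> for the edge of \<open>N\<close> at \<open>y\<close> increases the overlap, a
  contradiction.\<close>

lemma (in edges) gallai:
  assumes "(u, v) \<in> {(u, v). {u, v} \<in> E \<and> missable E u \<and> missable E v}\<^sup>*" "u \<noteq> v" "maximum_matching E N"
  shows "u \<in> \<Union>N \<or> v \<in> \<Union>N"
  using assms
proof (induction arbitrary: N rule: rtrancl_induct)
  case base
  then show ?case by simp
next
  case (step t v)
  then have tv: "{t, v} \<in> E" and mt: "missable E t" by auto
  have "card {t, v} = 2" using card2 [OF tv] .
  then have tnv: "t \<noteq> v" by auto
  show ?case
  proof (rule ccontr)
    assume "\<not> (u \<in> \<Union>N \<or> v \<in> \<Union>N)"
    then have uN: "u \<notin> \<Union>N" and vN: "v \<notin> \<Union>N" by auto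
    have mN: "maximum_matching E N" using step.prems by simp
    then have N: "matching E N" by (simp add: maximum_matching_def)
    have tu: "t \<noteq> u" using maximum_matching_no_free_edge [OF mN tv] uN vN by auto
    have IH: "u \<in> \<Union>K \<or> t \<in> \<Union>K" if "maximum_matching E K" for K
      using step.IH [OF _ that] tu by auto
    define P where "P K \<longleftrightarrow> maximum_matching E K \<and> t \<notin> \<Union>K" for K
    obtain K0 where "P K0" using mt by (auto simp: missable_def P_def)
    moreover have "\<forall>K. P K \<longrightarrow> card (N \<inter> K) < Suc (card N)"
      using matching_finite [OF N] by (auto simp: less_Suc_eq_le intro: card_mono)
    ultimately obtain K where K: "P K" "\<And>L. P L \<Longrightarrow> card (N \<inter> L) \<le> card (N \<inter> K)"
      using ex_has_greatest_nat [of P K0 "\<lambda>K. card (N \<inter> K)"] by blast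
    have mK: "maximum_matching E K" "t \<notin> \<Union>K" "matching E K" using K(1) by (auto simp: P_def maximum_matching_def)
    have uK: "u \<in> \<Union>K" using IH [OF mK(1)] mK(2) by auto
    have vK: "v \<in> \<Union>K" using maximum_matching_no_free_edge [OF mK(1) tv mK(2)] by auto
    have tN: "t \<in> \<Union>N" using IH [OF mN] uN by auto
    have fin: "finite (\<Union>N)" "finite (\<Union>K)" using N mK(3) by (auto intro!: finite_Union_matching simp del: finite_Union)
    have "card (\<Union>N) = card (\<Union>K)"
      using maximum_matching_card_eq [OF mN mK(1)] by (simp add: card_Union_matching N mK(3))
    then have "card (\<Union>N - \<Union>K) = card (\<Union>K - \<Union>N)"
      using fin by (simp add: card_Diff_subset_Int Int_commute)
    also have "\<dots> \<ge> card {u, v}"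
      using fin uK vK uN vN by (intro card_mono) auto
    finally have "card (\<Union>N - \<Union>K) \<ge> 2" using step.prems(1) by simp
    then have "\<not> \<Union>N - \<Union>K \<subseteq> {t}" using card_mono [of "{t}" "\<Union>N - \<Union>K"] by auto
    then obtain y where y: "y \<in> \<Union>N" "y \<notin> \<Union>K" "y \<noteq> t" by blast
    obtain g where g: "g \<in> N" "y \<in> g" using y by auto
    have gE: "g \<in> E" using g N by (auto simp: matching_def)
    obtain z where z: "g = {y, z}" "y \<noteq> z" using edge_obtain [OF gE g(2)] .
    have yzE: "{y, z} \<in> E" using gE z by simp
    have "z \<in> \<Union>K" using maximum_matching_no_free_edge [OF mK(1) yzE y(2)] by auto
    \<comment> \<open>The exchange removes \<open>h\<close>, the edge of \<open>K\<close> at the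
      partner \<open>z\<close> of \<open>y\<close>. It is not in \<open>N\<close>, whose edge at
      \<open>z\<close> is \<open>g\<close>, so the overlap gains \<open>g\<close> and loses
      nothing.\<close>
    then obtain h where h: "h \<in> K" "z \<in> h" by auto
    have gK: "g \<notin> K" using y(2) g(2) by auto
    have hN: "h \<notin> N" using matching_eqI [OF N g(1), of h z] z h gK by auto
    have "h \<in> E" using h mK(3) by (auto simp: matching_def)
    define L where "L = insert g (K - {h})"
    have UKh: "\<Union>(K - {h}) = \<Union>K - h" using matching_Union_Diff [OF mK(3) h(1)] .
    have "matching E L" unfolding L_def
    proof (rule matching_insert)
      show "matching E (K - {h})" using mK(3) by (auto intro: matching_subset)
      show "g \<in> E" by fact
      show "g \<inter> \<Union>(K - {h}) = {}" unfolding UKh z using y(2) h(2) by auto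
    qed
    moreover have "card L = card K"
      unfolding L_def using gK h(1) matching_finite [OF mK(3)]
      by (simp add: card_Suc_Diff1 del: card_Diff_insert)
    ultimately have "maximum_matching E L" using maximum_matchingI [OF mK(1)] by simp
    moreover have "t \<notin> \<Union>L"
    proof -
      have "\<Union>L = {y, z} \<union> (\<Union>K - h)" unfolding L_def UKh [symmetric] z by auto
      then show ?thesis using mK(2) y(3) \<open>z \<in> \<Union>K\<close> by auto
    qed
    ultimately have "card (N \<inter> L) \<le> card (N \<inter> K)" using K(2) by (simp add: P_def)
    moreover have "N \<inter> L = insert g (N \<inter> K)" using hN g(1) by (auto simp: L_def)
    moreover have "g \<notin> N \<inter> K" "finite (N \<inter> K)" using gK matching_finite [OF N] by auto
    ultimately show False by simp
  qed
qed

text \<open>The family consists of the components of the graph on \<open>D\<close>. Its size is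
  bounded by one maximum matching of the graph without \<open>A\<close>: the vertices of
  \<open>W - A\<close> missed by it lie in \<open>D\<close> by stability and in different components
  by \<open>gallai\<close>.\<close>

lemma (in edges) missable_components:
  assumes W: "finite W" "\<Union>E \<subseteq> W" and M: "maximum_matching E M" and cW: "card W = Suc (2 * card M)"
    and D: "D = {v \<in> W. missable E v}" and A: "A = {a \<in> W - D. \<exists>d\<in>D. {a, d} \<in> E}"
  obtains \<T> where "\<Union>\<T> = D" "{} \<notin> \<T>" "\<And>S T. S \<in> \<T> \<Longrightarrow> T \<in> \<T> \<Longrightarrow> S \<noteq> T \<Longrightarrow> S \<inter> T = {}"
    "\<And>T e. T \<in> \<T> \<Longrightarrow> e \<in> E \<Longrightarrow> e \<inter> T \<noteq> {} \<Longrightarrow> e \<subseteq> T \<union> A" "card A < card \<T>"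
proof -
  let ?F = "delete_vertices E A"
  have DA: "D \<inter> A = {}" using A by auto
  have finA: "finite A" and finD: "finite D" using W A D by auto
  have "\<not> missable E a \<and> (\<exists>d. {a, d} \<in> E \<and> missable E d)" if "a \<in> A" for a
    using that A D by auto
  note stable = missable_delete_set [OF finA this]
  interpret del: edges ?F by (rule edges_delete)
  \<comment> \<open>The relation refers to the graph without \<open>A\<close>, where
    \<open>gallai\<close> will be applied; missability there agrees with that in \<open>E\<close>
    outside \<open>A\<close>.\<close>
  define R where "R = {(u, v). {u, v} \<in> ?F \<and> missable ?F u \<and> missable ?F v}"
  have "sym R" by (auto simp: R_def sym_def insert_commute)
  then have symR: "(v, u) \<in> R\<^sup>*" if "(u, v) \<in> R\<^sup>*" for u v
    using that sym_rtrancl by (metis symD)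
  have RI: "(u, v) \<in> R" if "u \<in> D" "v \<in> D" "{u, v} \<in> E" for u v
    using that DA stable D by (auto simp: R_def delete_vertices_def)
  define C where "C u = {v \<in> D. (u, v) \<in> R\<^sup>*}" for u
  have Ceq: "C u = C v" if "(u, v) \<in> R\<^sup>*" for u v
    using that symR unfolding C_def by (meson rtrancl_trans)
  show ?thesis
  proof (rule that [of "C ` D"])
    show "\<Union>(C ` D) = D" by (auto simp: C_def)
    show "{} \<notin> C ` D" by (auto simp: C_def)
    show "S \<inter> T = {}" if ST: "S \<in> C ` D" "T \<in> C ` D" "S \<noteq> T" for S T
    proof (rule ccontr)
      assume "S \<inter> T \<noteq> {}"
      moreover obtain u v where "S = C u" "T = C v" using ST by auto
      ultimately obtain w where "(u, w) \<in> R\<^sup>*" "(v, w) \<in> R\<^sup>*" by (auto simp: C_def)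
      then have "S = T" using Ceq \<open>S = C u\<close> \<open>T = C v\<close> by metis
      then show False using ST by simp
    qed
    show "e \<subseteq> T \<union> A" if T: "T \<in> C ` D" and e: "e \<in> E" and eT: "e \<inter> T \<noteq> {}" for T e
    proof -
      obtain u where u: "T = C u" using T by auto
      obtain v where v: "v \<in> e" "v \<in> D" "(u, v) \<in> R\<^sup>*" using eT u by (auto simp: C_def)
      obtain w where w: "e = {v, w}" using edge_obtain [OF e v(1)] by metis
      have "w \<in> W" using w e W by auto
      show ?thesis
      proof (cases "w \<in> D")
        case True
        then have "(u, w) \<in> R\<^sup>*" using v RI [of v w] e w by (meson rtrancl.rtrancl_into_rtrancl)
        then show ?thesis using True v u w by (auto simp: C_def)
      next
        case False
        then have "w \<in> A" using A v e w \<open>w \<in> W\<close> by (auto simp: insert_commute)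
        then show ?thesis using v u w by (auto simp: C_def)
      qed
    qed
    obtain K where K: "maximum_matching ?F K" using del.maximum_matching_exists ..
    have mK: "matching E K" "\<Union>K \<inter> A = {}"
      using K by (auto simp: maximum_matching_def matching_delete_vertices)
    have cK: "card K + card A = card M" using stable K M by blast
    define U where "U = W - A - \<Union>K"
    have UK: "\<Union>K \<subseteq> W - A" using mK W by (auto simp: matching_def)
    have AW: "A \<subseteq> W" using A by auto
    have "card U = card W - card A - card (\<Union>K)"
      unfolding U_def using UK AW finA finite_Union_matching [OF mK(1)]
      by (simp add: card_Diff_subset)
    \<comment> \<open>The count is (2|M| + 1) - |A| - 2(|M| - |A|) = |A| + 1.\<close>
    then have cU: "card U = Suc (card A)"
      using cK cW card_Union_matching [OF mK(1)] by simp
    have UD: "U \<subseteq> D"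
    proof
      fix w assume w: "w \<in> U"
      then have "missable ?F w" using K by (auto simp: U_def missable_def)
      then show "w \<in> D" using stable w D by (auto simp: U_def)
    qed
    have "inj_on C U"
    proof (rule inj_onI, rule ccontr)
      fix u v assume uv: "u \<in> U" "v \<in> U" "C u = C v" "u \<noteq> v"
      have "v \<in> C v" using uv UD by (auto simp: C_def)
      then have "(u, v) \<in> R\<^sup>*" using uv(3) by (auto simp: C_def)
      then have "u \<in> \<Union>K \<or> v \<in> \<Union>K" using del.gallai [OF _ uv(4) K] by (simp add: R_def)
      then show False using uv by (auto simp: U_def)
    qed
    then have "card U = card (C ` U)" by (simp add: card_image)
    also have "\<dots> \<le> card (C ` D)" using UD finD by (intro card_mono) auto
    finally show "card A < card (C ` D)" using cU by simp
  qed
qed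

section \<open>Vertices of small degree\<close>

lemma edges_of_simple_graph: "simple_graph V E \<Longrightarrow> F \<subseteq> E \<Longrightarrow> edges F"
proof (unfold_locales)
  assume G: "simple_graph V E" "F \<subseteq> E"
  have "F \<subseteq> Pow V" "finite (Pow V)" using G by (auto simp: simple_graph_def)
  then show "finite F" by (rule finite_subset)
  show "card e = 2" if "e \<in> F" for e using G that by (auto simp: simple_graph_def)
qed

text \<open>The symmetric difference of \<open>M\<close> and \<open>N\<close> contains the alternating path.\<close>

lemma missable_in_switch_set:
  assumes G: "simple_graph V E" and M: "matching E M" and x: "x \<in> V" "x \<notin> \<Union>M"
    and W: "W = insert x (\<Union>M)" and N: "matching {e \<in> E. e \<subseteq> W} N" "card N = card M"
    and v: "v \<in> W" "v \<notin> \<Union>N"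
  shows "v \<in> switch_set V E M x"
proof (cases "v = x")
  case True
  then show ?thesis by (simp add: switch_set_def)
next
  case False
  interpret edges E by (rule edges_of_simple_graph [OF G order_refl])
  have mN: "matching E N" using N(1) by (auto simp: matching_def)
  have NW: "\<Union>N \<subseteq> W" using N(1) by (auto simp: matching_def)
  have finW: "finite W" using finite_Union_matching [OF M] by (simp add: W)
  have WV: "W \<subseteq> V" using G M x(1) by (auto simp: W simple_graph_def matching_def)
  have "card W = Suc (2 * card M)"
    using x(2) finite_Union_matching [OF M] card_Union_matching [OF M] by (simp add: W)
  then have "card (W - {v}) = card (\<Union>N)"
    using v(1) finW card_Union_matching [OF mN] N(2) by simp
  \<comment> \<open>By counting, \<open>N\<close> misses exactly \<open>v\<close> in
    \<open>W\<close>, just as \<open>M\<close> misses exactly \<open>x\<close>.\<close>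
  then have UN: "\<Union>N = W - {v}"
    using NW v(2) finW by (intro card_subset_eq) auto
  have UM: "\<Union>M = W - {x}" using x(2) W by auto
  have "x \<in> W" by (simp add: W)
  then have "x \<in> \<Union>N" unfolding UN using False by simp
  from alternating_walk [OF mN M this x(2)] obtain p where p: "p \<noteq> []" "hd p = x" "distinct p"
      "set p \<subseteq> \<Union>N \<union> \<Union>M" "path_edges p \<noteq> []"
    and alt: "\<And>i. i < length (path_edges p) \<Longrightarrow> path_edges p ! i \<in> (if even i then N - M else M - N)"
    and lst: "last p \<in> (if even (length (path_edges p)) then \<Union>M - \<Union>N else \<Union>N - \<Union>M - {x})"
    by blast
  \<comment> \<open>An odd path would end at a vertex other than \<open>x\<close> covered by
    \<open>N\<close> only, but \<open>M\<close> covers all of \<open>W\<close> except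
    \<open>x\<close>. An even one ends where only \<open>M\<close> covers, which is
    \<open>v\<close>.\<close>
  have ev: "even (length (path_edges p))" and lv: "last p = v"
    using lst unfolding UN UM by (auto split: if_splits)
  have inM: "path_edges p ! i \<in> M \<longleftrightarrow> odd i" if "i < length (path_edges p)" for i
    using alt [OF that] by (auto split: if_splits)
  have "set (path_edges p) \<subseteq> E"
  proof
    fix e assume "e \<in> set (path_edges p)"
    then obtain i where "i < length (path_edges p)" "e = path_edges p ! i" by (auto simp: in_set_conv_nth)
    then show "e \<in> E" using alt [of i] mN M by (auto simp: matching_def split: if_splits)
  qed
  moreover have "set p \<subseteq> V"
  proof -
    have "\<Union>N \<union> \<Union>M \<subseteq> W" using NW by (auto simp: W)
    then show ?thesis using p(4) WV by (meson subset_trans)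
  qed
  ultimately have "graph_path V E p" using p by (simp add: graph_path_def)
  moreover have "path_edges p ! i \<in> M \<longleftrightarrow> path_edges p ! Suc i \<notin> M" if "Suc i < length (path_edges p)" for i
    using inM [of i] inM [of "Suc i"] that by auto
  ultimately have "alternating_path V E M p" by (simp add: alternating_path_def)
  moreover have "hd (path_edges p) \<notin> M"
    using inM [of 0] p(5) by (simp add: hd_conv_nth)
  moreover have "last (path_edges p) \<in> M"
    using inM [of "length (path_edges p) - 1"] p(5) ev by (simp add: last_conv_nth)
  ultimately have "switchable V E M x v"
    unfolding switchable_def using p(2,5) ev lv by blast
  then show ?thesis by (simp add: switch_set_def)
qed

text \<open>The degree sum over \<open>T\<close> counts edges inside \<open>T\<close> twice and the
  other edges meeting \<open>T\<close> once, so it is the number of edges meeting \<open>T\<close>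
  plus the number inside \<open>T\<close>. The latter is at most \<open>3 * card T - 3\<close> by
  planarity.\<close>

lemma planar_incident_edges_bound:
  assumes G: "planar_graph V E" and T: "T \<subseteq> V" "T \<noteq> {}"
    and deg: "\<And>v. v \<in> T \<Longrightarrow> 6 \<le> vertex_degree E v"
  shows "3 * card T + 3 \<le> card {e \<in> E. e \<inter> T \<noteq> {}}"
proof -
  let ?I = "{e \<in> E. e \<inter> T \<noteq> {}}" and ?T = "{e \<in> E. e \<subseteq> T}"
  have simple: "simple_graph V E" using G by (simp add: planar_graph_def)
  interpret edges E by (rule edges_of_simple_graph [OF simple order_refl])
  have finT: "finite T" using T(1) simple finite_subset by (auto simp: simple_graph_def)
  have finI: "finite ?I" using finE by simp
  have inc: "card {v \<in> T. v \<in> e} \<le> 1 + (if e \<subseteq> T then 1 else 0)" if e: "e \<in> ?I" for e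
  proof (cases "e \<subseteq> T")
    case True
    then have "{v \<in> T. v \<in> e} = e" by auto
    then show ?thesis using True card2 e by auto
  next
    case False
    then have "{v \<in> T. v \<in> e} \<subset> e" by auto
    then have "card {v \<in> T. v \<in> e} < card e" using e edge_finite by (intro psubset_card_mono) auto
    then show ?thesis using False card2 e by auto
  qed
  have "6 * card T = (\<Sum>v\<in>T. 6)" by simp
  also have "\<dots> \<le> (\<Sum>v\<in>T. vertex_degree E v)" using deg by (rule sum_mono)
  also have "\<dots> = (\<Sum>v\<in>T. card {e \<in> ?I. v \<in> e})"
    unfolding vertex_degree_def by (intro sum.cong arg_cong [where f = card]) auto
  also have "\<dots> = (\<Sum>e\<in>?I. card {v \<in> T. v \<in> e})"
    by (rule sum_multicount_gen) (use finT finI in auto)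
  also have "\<dots> \<le> (\<Sum>e\<in>?I. 1 + (if e \<subseteq> T then 1 else 0))" using inc by (rule sum_mono)
  also have "\<dots> = card ?I + (\<Sum>e\<in>?I. if e \<subseteq> T then 1 else 0)"
    by (simp only: sum.distrib card_eq_sum)
  also have "(\<Sum>e\<in>?I. if e \<subseteq> T then 1 else 0) = card {e \<in> ?I. e \<subseteq> T}"
    unfolding card_eq_sum by (rule sum.inter_filter [OF finI, symmetric])
  also have "card ?I + card {e \<in> ?I. e \<subseteq> T} \<le> card ?I + card ?T"
    using finE by (intro add_left_mono card_mono) auto
  finally have "6 * card T \<le> card ?I + card ?T" .
  moreover have "planar_graph T ?T" by (rule planar_subgraph [OF G T(1)]) auto
  then have "card ?T + 3 \<le> 3 * card T" using T(2) by (rule planar_card_edges_bound)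
  ultimately show ?thesis by linarith
qed

theorem theorem4p1:
  fixes V :: "'a set" and E M :: "'a set set" and x :: 'a
  assumes "planar_graph V E"
    and "maximum_matching E M"
    and "x \<in> V"
    and "unmatched M x"
  shows "\<exists>v \<in> switch_set V E M x. vertex_degree E v \<le> 5"
proof (rule ccontr)
  assume contra: "\<not> (\<exists>v \<in> switch_set V E M x. vertex_degree E v \<le> 5)"
  have simple: "simple_graph V E" using assms(1) by (simp add: planar_graph_def)
  interpret edges E by (rule edges_of_simple_graph [OF simple order_refl])
  have M: "matching E M" using assms(2) by (simp add: maximum_matching_def)
  have xM: "x \<notin> \<Union>M" using assms(4) by (auto simp: unmatched_def)
  \<comment> \<open>Other unmatched vertices are left out so that \<open>M\<close> misses exactly
    one vertex of \<open>W\<close>; this forces the alternating paths to vertices of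
    \<open>D\<close> to start at \<open>x\<close>.\<close>
  define W where "W = insert x (\<Union>M)"
  define H where "H = {e \<in> E. e \<subseteq> W}"
  interpret H: edges H by (rule edges_of_simple_graph [OF simple]) (auto simp: H_def)
  have matE: "matching E N" if "matching H N" for N using that by (auto simp: matching_def H_def)
  have "matching H M" using M by (auto simp: matching_def H_def W_def)
  then have maxM: "maximum_matching H M"
    using assms(2) matE by (auto simp: maximum_matching_def)
  have WV: "W \<subseteq> V" using simple M assms(3) by (auto simp: W_def simple_graph_def matching_def)
  have finW: "finite W" using finite_Union_matching [OF M] by (simp add: W_def)
  have cardW: "card W = Suc (2 * card M)"
    using xM finite_Union_matching [OF M] card_Union_matching [OF M] by (simp add: W_def)
  have HW: "\<Union>H \<subseteq> W" by (auto simp: H_def)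
  define D where "D = {v \<in> W. missable H v}"
  define A where "A = {a \<in> W - D. \<exists>d\<in>D. {a, d} \<in> H}"
  obtain \<T> where \<T>: "\<Union>\<T> = D" "{} \<notin> \<T>" "\<And>S T. S \<in> \<T> \<Longrightarrow> T \<in> \<T> \<Longrightarrow> S \<noteq> T \<Longrightarrow> S \<inter> T = {}"
    "\<And>T e. T \<in> \<T> \<Longrightarrow> e \<in> H \<Longrightarrow> e \<inter> T \<noteq> {} \<Longrightarrow> e \<subseteq> T \<union> A" "card A < card \<T>"
    by (rule H.missable_components [OF finW HW maxM cardW D_def A_def], rule that)
  have finD: "finite D" and finA: "finite A" using finW by (auto simp: D_def A_def)
  have DA: "D \<inter> A = {}" "D \<union> A \<subseteq> W" by (auto simp: D_def A_def)
  have deg: "6 \<le> vertex_degree E v" if v: "v \<in> D" for v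
  proof -
    obtain N where N: "maximum_matching H N" "v \<notin> \<Union>N" using v by (auto simp: D_def missable_def)
    have "matching {e \<in> E. e \<subseteq> W} N" using N(1) by (simp add: maximum_matching_def H_def)
    moreover have "card N = card M" using maximum_matching_card_eq [OF N(1) maxM] .
    ultimately have "v \<in> switch_set V E M x"
      using missable_in_switch_set [OF simple M assms(3) xM W_def _ _ _ N(2)] v by (auto simp: D_def)
    then show ?thesis using contra by force
  qed
  \<comment> \<open>Degrees are taken in the whole graph, so all edges at \<open>D\<close> must lie
    in \<open>H\<close>. If \<open>d\<close> had a neighbour outside \<open>W\<close>, a matching of
    \<open>H\<close> of size \<open>card M\<close> missing \<open>d\<close> could be enlarged by
    that edge, although \<open>M\<close> is maximum in \<open>E\<close>.\<close>
  have inH: "e \<in> H" if e: "e \<in> E" "e \<inter> D \<noteq> {}" for e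
  proof -
    obtain d where d: "d \<in> e" "d \<in> D" using e(2) by auto
    obtain y where y: "e = {d, y}" using edge_obtain [OF e(1) d(1)] by metis
    obtain N where N: "maximum_matching H N" "d \<notin> \<Union>N" using d(2) by (auto simp: D_def missable_def)
    have mN: "matching E N" using N(1) by (intro matE) (simp add: maximum_matching_def)
    have cN: "card N = card M" using maximum_matching_card_eq [OF N(1) maxM] .
    have "y \<in> W"
    proof (rule ccontr)
      assume "y \<notin> W"
      then have "y \<notin> \<Union>N" using N(1) HW by (auto simp: maximum_matching_def matching_def)
      moreover have "maximum_matching E N" using maximum_matchingI [OF assms(2) mN] cN by simp
      ultimately show False using maximum_matching_no_free_edge [of N d y] N(2) e(1) y by simp
    qed
    then show ?thesis using d(2) y e(1) by (auto simp: H_def D_def)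
  qed
  define I where "I T = {e \<in> E. e \<inter> T \<noteq> {}}" for T
  have fin\<T>: "finite \<T>" using finD \<T>(1) by (metis finite_UnionD)
  have TD: "T \<subseteq> D" if "T \<in> \<T>" for T using that \<T>(1) by auto
  have "card (\<Union>\<T>) = (\<Sum>T\<in>\<T>. card T)"
    using \<T>(3) finite_subset [OF TD finD] by (intro card_Union_disjoint) (auto simp: pairwise_def disjnt_def)
  then have "3 * card D + 3 * card \<T> = (\<Sum>T\<in>\<T>. 3 * card T + 3)"
    by (simp add: \<T>(1) sum.distrib sum_distrib_left)
  also have "\<dots> \<le> (\<Sum>T\<in>\<T>. card (I T))"
  proof (rule sum_mono)
    fix T assume T: "T \<in> \<T>"
    have "T \<subseteq> V" using TD [OF T] WV by (auto simp: D_def)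
    moreover have "T \<noteq> {}" using T \<T>(2) by auto
    ultimately show "3 * card T + 3 \<le> card (I T)"
      unfolding I_def using deg TD [OF T] by (intro planar_incident_edges_bound [OF assms(1)]) auto
  qed
  also have "\<dots> = card (\<Union>T\<in>\<T>. I T)"
  proof (rule card_UN_disjoint [symmetric])
    show "finite \<T>" by fact
    show "\<forall>T\<in>\<T>. finite (I T)" using finE by (simp add: I_def)
    \<comment> \<open>An edge meeting one component has its other end in the same component or in
      \<open>A\<close>, so no edge is counted for two components.\<close>
    show "\<forall>S\<in>\<T>. \<forall>T\<in>\<T>. S \<noteq> T \<longrightarrow> I S \<inter> I T = {}"
    proof (intro ballI impI equals0I)
      fix S T e assume ST: "S \<in> \<T>" "T \<in> \<T>" "S \<noteq> T" and e: "e \<in> I S \<inter> I T"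
      have "e \<in> H" using e TD [OF ST(1)] by (intro inH) (auto simp: I_def)
      then have "e \<subseteq> S \<union> A" using \<T>(4) [OF ST(1)] e by (auto simp: I_def)
      moreover have "T \<inter> (S \<union> A) = {}" using \<T>(3) [OF ST] DA(1) TD [OF ST(2)] by auto
      ultimately show False using e by (auto simp: I_def)
    qed
  qed
  also have "(\<Union>T\<in>\<T>. I T) = I D" using \<T>(1) by (auto simp: I_def)
  also have "card (I D) + 3 \<le> 3 * card (D \<union> A)"
  proof (rule planar_card_edges_bound)
    show "planar_graph (D \<union> A) (I D)"
    proof (rule planar_subgraph [OF assms(1)])
      show "D \<union> A \<subseteq> V" using DA(2) WV by auto
      show "I D \<subseteq> E" by (auto simp: I_def)
      fix e assume e: "e \<in> I D"
      then obtain T where T: "T \<in> \<T>" "e \<inter> T \<noteq> {}" using \<T>(1) by (auto simp: I_def)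
      have "e \<in> H" using e by (intro inH) (auto simp: I_def)
      then show "e \<subseteq> D \<union> A" using \<T>(4) [OF T(1) _ T(2)] TD [OF T(1)] by blast
    qed
    \<comment> \<open>\<open>M\<close> itself is a maximum matching of \<open>H\<close> missing
      \<open>x\<close>.\<close>
    have "x \<in> D" using xM maxM by (auto simp: D_def W_def missable_def)
    then show "D \<union> A \<noteq> {}" by auto
  qed
  \<comment> \<open>Cancelling \<open>3 * card D\<close> leaves
    \<open>card \<T> + 1 \<le> card A\<close>, contrary to
    \<open>card A < card \<T>\<close>.\<close>
  finally have "3 * card D + 3 * card \<T> + 3 \<le> 3 * card (D \<union> A)" by simp
  also have "card (D \<union> A) = card D + card A"
    using finD finA DA(1) by (rule card_Un_disjoint)
  finally show False using \<T>(5) by simp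
qed

end
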